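(* Let $d\ge3$. For all $h>h_\star$ and $\xi>0$, $$\lim_{N\to\infty}\mathbb P^{\mathbb T^d_N}\Big[\big|\mathcal C_{\max}^{\mathbb T^d_N,h}\big|\ge\xi N^d\Big]=0.$$
   Context: $\mathbb T^d_N=(\mathbb Z/N\mathbb Z)^d$ is the discrete torus and $\mathbb Z^d$ the integer lattice, both with nearest-neighbour graph structure, $d\ge3$ fixed. Simple random walk moves at each step to $x\pm e_i$ (modulo $N$ on the torus) with probability $\frac1{2d}$ each; $P_x^{\mathbb T^d_N}$, $P_x^{\mathbb Z^d}$ are its laws started at $x$; $(X_k)_{k\ge0}$ is the discrete-time walk and $(\overline X_t)_{t\ge0}$ the continuous-time walk with i.i.d. Exp(1) holding times. Zero-average Green function: $G_{\mathbb T^d_N}(x,y)=\int_0^\infty\big(P_x^{\mathbb T^d_N}[\overline X_t=y]-\frac1{N^d}\big)dt$. Under $\mathbb P^{\mathbb T^d_N}$, $(\Psi_{\mathbb T^d_N}(x))_{x\in\mathbb T^d_N}$ (the zero-average Gaussian free field) is a centered Gaussian field with covariance $G_{\mathbb T^d_N}(\cdot,\cdot)$. Green function on $\mathbb Z^d$: $g_{\mathbb Z^d}(x,y)=\sum_{k\ge0}P_x^{\mathbb Z^d}[X_k=y]$. Under $\mathbb P^{\mathbb Z^d}$, $(\varphi_{\mathbb Z^d}(x))_{x\in\mathbb Z^d}$ (the Gaussian free field) is a centered Gaussian field with covariance $g_{\mathbb Z^d}(\cdot,\cdot)$. Level sets: $E_{\Psi_{\mathbb T^d_N}}^{\ge h}=\{x\in\mathbb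 T^d_N:\Psi_{\mathbb T^d_N}(x)\ge h\}$ and $E_{\varphi_{\mathbb Z^d}}^{\ge h}=\{x\in\mathbb Z^d:\varphi_{\mathbb Z^d}(x)\ge h\}$. $\mathcal C_{\max}^{\mathbb T^d_N,h}$ is a connected component of $E_{\Psi_{\mathbb T^d_N}}^{\ge h}$ with maximal number of vertices (empty if the level set is empty); $|\cdot|$ is cardinality. Critical value: $h_\star=\inf\{h\in\mathbb R:\mathbb P^{\mathbb Z^d}[0\xleftrightarrow{\varphi_{\mathbb Z^d}\ge h}\infty]=0\}$, where $\{0\xleftrightarrow{\varphi_{\mathbb Z^d}\ge h}\infty\}$ is the event that $0$ lies in an infinite connected component of $E_{\varphi_{\mathbb Z^d}}^{\ge h}$. *)

theory Defs
  imports "HOL-Probability.Probability"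
begin

section \<open>Lattice and torus\<close>

text \<open>
  The dimension is \<open>CARD('d)\<close>. A vertex of \<open>(\<int>/N\<int>)\<^sup>d\<close>, for \<open>N \<ge> 1\<close>, is represented by its
  residues in \<open>{0..<N}\<close>. Every notion that is common to the lattice and the torus takes as
  argument a reduction map \<open>r\<close> on \<open>\<int>\<^sup>d\<close>: it is \<open>id\<close> for the lattice and \<open>wrap N\<close> for the torus.
\<close>

definition wrap :: "nat \<Rightarrow> int ^ 'd \<Rightarrow> int ^ 'd::finite" where
  "wrap N x = (\<chi> i. x $ i mod int N)"

definition torus :: "nat \<Rightarrow> (int ^ 'd::finite) set" where
  "torus N = {x. \<forall>i. 0 \<le> x $ i \<and> x $ i < int N}"

definition unit_steps :: "(int ^ 'd::finite) set" where
  "unit_steps = {axis i s | i s. s \<in> {1, -1}}"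

definition adjacent :: "(int ^ 'd \<Rightarrow> int ^ 'd::finite) \<Rightarrow> int ^ 'd \<Rightarrow> int ^ 'd \<Rightarrow> bool" where
  "adjacent r x y \<longleftrightarrow> (\<exists>e\<in>unit_steps. y = r (x + e))"

definition component ::
    "(int ^ 'd \<Rightarrow> int ^ 'd::finite) \<Rightarrow> (int ^ 'd) set \<Rightarrow> int ^ 'd \<Rightarrow> (int ^ 'd) set" where
  "component r S x = {y. (\<lambda>u v. u \<in> S \<and> v \<in> S \<and> adjacent r u v)\<^sup>*\<^sup>* x y}"

definition components ::
    "(int ^ 'd \<Rightarrow> int ^ 'd::finite) \<Rightarrow> (int ^ 'd) set \<Rightarrow> (int ^ 'd) set set" where
  "components r S = component r S ` S"

section \<open>Simple random walk\<close>

text \<open>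
  The walks from all starting points live on one probability space, which carries independent
  sequences of i.i.d. uniform increments and of i.i.d. Exp(1) holding times. The increments are
  uniform on the \<open>2d\<close> unit vectors of \<open>\<int>\<^sup>d\<close> and are reduced afterwards, so that on small tori
  neighbours reached in several ways get the corresponding multiple of \<open>1/(2d)\<close>.
\<close>

definition walk_space :: "((nat \<Rightarrow> int ^ 'd::finite) \<times> (nat \<Rightarrow> real)) measure" where
  "walk_space =
     (\<Pi>\<^sub>M k\<in>UNIV. measure_pmf (pmf_of_set unit_steps)) \<Otimes>\<^sub>M
     (\<Pi>\<^sub>M k\<in>UNIV. density lborel (\<lambda>t. ennreal (exponential_density 1 t)))"

primrec walk ::
    "(int ^ 'd \<Rightarrow> int ^ 'd::finite) \<Rightarrow> int ^ 'd \<Rightarrow> (nat \<Rightarrow> int ^ 'd) \<Rightarrow> nat \<Rightarrow> int ^ 'd" where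
  "walk r x \<eta> 0 = x"
| "walk r x \<eta> (Suc k) = r (walk r x \<eta> k + \<eta> k)"

text \<open>The number of jumps in \<open>[0, t]\<close>; the set is infinite only on a null event.\<close>

definition jump_count :: "(nat \<Rightarrow> real) \<Rightarrow> real \<Rightarrow> nat" where
  "jump_count \<tau> t = card {n. (\<Sum>i\<le>n. \<tau> i) \<le> t}"

definition cont_walk ::
    "(int ^ 'd \<Rightarrow> int ^ 'd::finite) \<Rightarrow> int ^ 'd \<Rightarrow> (nat \<Rightarrow> int ^ 'd) \<times> (nat \<Rightarrow> real)
      \<Rightarrow> real \<Rightarrow> int ^ 'd" where
  "cont_walk r x \<omega> t = walk r x (fst \<omega>) (jump_count (snd \<omega>) t)"

section \<open>Green functions\<close>

definition green_torus :: "nat \<Rightarrow> int ^ 'd \<Rightarrow> int ^ 'd::finite \<Rightarrow> real" where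
  "green_torus N x y =
     (LINT t:{0..}|lborel.
        \<P>(\<omega> in walk_space. cont_walk (wrap N) x \<omega> t = y) - 1 / real N ^ CARD('d))"

text \<open>The series converges exactly for \<open>CARD('d) \<ge> 3\<close>, the only case in which it is used.\<close>

definition green_lattice :: "int ^ 'd \<Rightarrow> int ^ 'd::finite \<Rightarrow> real" where
  "green_lattice x y = (\<Sum>k. \<P>(\<omega> in walk_space. walk id x (fst \<omega>) k = y))"

section \<open>Gaussian fields\<close>

text \<open>
  Degenerate (constant) Gaussian variables are included: the zero-average field is degenerate,
  since its sum over the torus vanishes almost surely.
\<close>

definition gaussian_rv :: "'a measure \<Rightarrow> ('a \<Rightarrow> real) \<Rightarrow> bool" where
  "gaussian_rv M Z \<longleftrightarrow> Z \<in> borel_measurable M \<and>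
     (\<exists>m s. s \<ge> 0 \<and>
        distr M borel Z =
          (if s = 0 then return borel m
           else density lborel (\<lambda>z. ennreal (normal_density m s z))))"

definition centered_gaussian_field ::
    "'a measure \<Rightarrow> 'v set \<Rightarrow> ('v \<Rightarrow> 'a \<Rightarrow> real) \<Rightarrow> ('v \<Rightarrow> 'v \<Rightarrow> real) \<Rightarrow> bool" where
  "centered_gaussian_field M V Z C \<longleftrightarrow> prob_space M \<and>
     (\<forall>F a. finite F \<and> F \<subseteq> V \<longrightarrow> gaussian_rv M (\<lambda>\<omega>. \<Sum>x\<in>F. a x * Z x \<omega>)) \<and>
     (\<forall>x\<in>V. (LINT \<omega>|M. Z x \<omega>) = 0) \<and>
     (\<forall>x\<in>V. \<forall>y\<in>V. (LINT \<omega>|M. Z x \<omega> * Z y \<omega>) = C x y)"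

definition zero_average_gff ::
    "nat \<Rightarrow> 'a measure \<Rightarrow> (int ^ 'd::finite \<Rightarrow> 'a \<Rightarrow> real) \<Rightarrow> bool" where
  "zero_average_gff N M \<Psi> \<longleftrightarrow> centered_gaussian_field M (torus N) \<Psi> (green_torus N)"

definition lattice_gff :: "'a measure \<Rightarrow> (int ^ 'd::finite \<Rightarrow> 'a \<Rightarrow> real) \<Rightarrow> bool" where
  "lattice_gff M \<phi> \<longleftrightarrow> centered_gaussian_field M UNIV \<phi> green_lattice"

section \<open>Level sets\<close>

definition level_set :: "'v set \<Rightarrow> ('v \<Rightarrow> real) \<Rightarrow> real \<Rightarrow> 'v set" where
  "level_set V f h = {x \<in> V. f x \<ge> h}"

definition C_max :: "nat \<Rightarrow> (int ^ 'd::finite \<Rightarrow> real) \<Rightarrow> real \<Rightarrow> (int ^ 'd) set" where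
  "C_max N f h =
     (let E = level_set (torus N) f h in
      if E = {} then {} else (ARG_MAX card C. C \<in> components (wrap N) E))"

definition percolates :: "(int ^ 'd::finite \<Rightarrow> real) \<Rightarrow> real \<Rightarrow> bool" where
  "percolates f h \<longleftrightarrow> (\<exists>C\<in>components id (level_set UNIV f h). 0 \<in> C \<and> infinite C)"

text \<open>
  The infimum over real levels is taken in the extended reals, so that finiteness of the
  critical value is not built into the definition.
\<close>

definition h_star :: "'a measure \<Rightarrow> (int ^ 'd::finite \<Rightarrow> 'a \<Rightarrow> real) \<Rightarrow> ereal" where
  "h_star M \<phi> = (INF h \<in> {h. \<P>(\<omega> in M. percolates (\<lambda>x. \<phi> x \<omega>) h) = 0}. ereal h)"

end

theory Submission
  imports Defs
begin

text \<open>
  Two facts make the theorem true: a giant component makes many vertices locally connected to a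
  large distance, and locally the field on the torus looks like the field on the lattice.

  If the largest component has at least \<open>\<xi> * N ^ d\<close> vertices, then around each of them the level set
  crosses the cube of radius \<open>R\<close>, as soon as \<open>\<xi> * N ^ d\<close> exceeds the number of points of that cube. So by
  a first moment argument the probability in question is at most \<open>1 / \<xi>\<close> times the largest probability,
  over the vertices \<open>x\<close>, of such a crossing around \<open>x\<close> (\<open>giant_component_probability_le\<close>).

  For fixed \<open>R\<close> the crossing is an increasing event of finitely many coordinates. The covariances of the
  field around \<open>x\<close> converge to those on the lattice (\<open>green_torus_tendsto\<close>). Since the fields are Gaussian
  and centred, their finite-dimensional laws converge too, and the upper limit of the crossing
  probability at level \<open>h\<close> is at most the one on the lattice at any smaller level \<open>h'\<close>
  (\<open>increasing_event_limit\<close>). With \<open>h'\<close> still above the critical value, the latter tends to zero as \<open>R\<close>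
  grows, because percolation is the decreasing limit of the crossings
  (\<open>lattice_gff_crossing_vanishes\<close>).

  The Green functions are handled through the heat kernel. By Fourier analysis on the torus, the
  deviation of the heat kernel from its average \<open>1 / N ^ d\<close> is at most a constant times
  \<open>t powr (- 3 / 2)\<close> for \<open>t \<ge> 1\<close>, uniformly in \<open>N\<close> (\<open>heat_bound\<close>). This dominates the time integral that
  defines the zero-average Green function, while pointwise in time the walk on a large torus behaves
  like the walk on the lattice.

  Convergence in law is obtained from the expectations of cosines of linear combinations, by
  approximating continuous functions of the coordinates with trigonometric polynomials that are
  bounded on the whole space (\<open>continuous_expectation_convergence\<close>).
\<close>

section \<open>Crossings of boxes\<close>

definition cube :: "nat \<Rightarrow> (int ^ 'd::finite) set" where
  "cube R = {v. \<forall>i. \<bar>v $ i\<bar> \<le> int R}"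

lemma finite_vec_interval: "finite {v :: int ^ 'd::finite. \<forall>i. a \<le> v $ i \<and> v $ i \<le> b}"
proof (rule finite_subset)
  show "{v :: int ^ 'd. \<forall>i. a \<le> v $ i \<and> v $ i \<le> b}
      \<subseteq> vec_lambda ` (PiE UNIV (\<lambda>_. {a..b}))"
  proof
    fix v :: "int ^ 'd" assume "v \<in> {v. \<forall>i. a \<le> v $ i \<and> v $ i \<le> b}"
    then have "v = vec_lambda (\<lambda>i. v $ i)" "(\<lambda>i. v $ i) \<in> PiE UNIV (\<lambda>_. {a..b})" by auto
    then show "v \<in> vec_lambda ` (PiE UNIV (\<lambda>_. {a..b}))" by blast
  qed
qed (auto intro!: finite_imageI finite_PiE)

lemma finite_cube [simp]: "finite (cube R :: (int ^ 'd::finite) set)"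
proof -
  have "cube R = {v :: int ^ 'd. \<forall>i. - int R \<le> v $ i \<and> v $ i \<le> int R}"
    unfolding cube_def by (auto simp: abs_le_iff) (metis minus_le_iff)+
  then show ?thesis by (simp only: finite_vec_interval)
qed

lemma cube_mono: "R \<le> R' \<Longrightarrow> cube R \<subseteq> cube R'"
  unfolding cube_def using order_trans[OF _ of_nat_mono[of R R']] by blast

lemma zero_in_cube [simp]: "0 \<in> cube R" by (simp add: cube_def)

lemma finite_subset_cube:
  assumes "finite (S :: (int ^ 'd::finite) set)" shows "\<exists>R. S \<subseteq> cube R"
proof -
  let ?m = "\<lambda>v :: int ^ 'd. nat (\<Sum>i\<in>UNIV. \<bar>v $ i\<bar>)"
  have "v \<in> cube (\<Sum>v\<in>S. ?m v)" if "v \<in> S" for v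
  proof -
    have m: "?m v \<le> (\<Sum>v\<in>S. ?m v)" using that assms by (intro member_le_sum) auto
    have "\<bar>v $ i\<bar> \<le> int (\<Sum>v\<in>S. ?m v)" for i
    proof -
      have "\<bar>v $ i\<bar> \<le> (\<Sum>i\<in>UNIV. \<bar>v $ i\<bar>)" by (rule member_le_sum) auto
      also have "\<dots> \<le> int (?m v)" by linarith
      also have "\<dots> \<le> int (\<Sum>v\<in>S. ?m v)" using m by (simp only: of_nat_le_iff)
      finally show ?thesis .
    qed
    then show ?thesis unfolding cube_def by blast
  qed
  then show ?thesis by blast
qed

lemma unit_step_abs_le: "e \<in> unit_steps \<Longrightarrow> \<bar>e $ i\<bar> \<le> 1"
  unfolding unit_steps_def by (auto simp: axis_def)

lemma adjacent_cube_Suc: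
  assumes "u \<in> cube R" "adjacent id u w" shows "w \<in> cube (Suc R)"
proof -
  from assms(2) obtain e where e: "e \<in> unit_steps" "w = u + e" by (auto simp: adjacent_def)
  have "\<bar>u $ i\<bar> \<le> int R" for i using assms(1) by (auto simp: cube_def)
  moreover have "\<bar>e $ i\<bar> \<le> 1" for i using unit_step_abs_le[OF e(1)] .
  ultimately have "\<bar>u $ i\<bar> + \<bar>e $ i\<bar> \<le> int R + 1" for i by (rule add_mono)
  then have "\<bar>u $ i + e $ i\<bar> \<le> int R + 1" for i
    by (rule order_trans[OF abs_triangle_ineq])
  then show ?thesis unfolding cube_def e by (simp add: add.commute)
qed

lemma uminus_unit_step:
  assumes "e \<in> unit_steps" shows "- e \<in> (unit_steps :: (int ^ 'd::finite) set)"
proof -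
  have "- axis i s = axis i (- s)" for i :: 'd and s :: int by (auto simp: axis_def vec_eq_iff)
  with assms show "- e \<in> unit_steps" unfolding unit_steps_def by fastforce
qed

lemma adjacent_id_sym: "adjacent id u v \<Longrightarrow> adjacent id v u"
proof -
  assume "adjacent id u v"
  then obtain e where "e \<in> unit_steps" "v = u + e" by (auto simp: adjacent_def)
  then have "u = v + (- e)" "- e \<in> unit_steps" by (auto simp: uminus_unit_step)
  then show ?thesis unfolding adjacent_def by auto
qed

lemma wrap_add_wrap: "wrap N (wrap N x + y) = wrap N (x + y)"
  by (simp add: wrap_def vec_eq_iff mod_add_left_eq)

lemma wrap_wrap [simp]: "wrap N (wrap N x) = wrap N x"
  by (simp add: wrap_def)

lemma wrap_in_torus: "N \<ge> 1 \<Longrightarrow> wrap N x \<in> torus N"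
  by (simp add: wrap_def torus_def)

lemma wrap_torus: "x \<in> torus N \<Longrightarrow> wrap N x = x"
  by (simp add: wrap_def torus_def vec_eq_iff)

lemma adjacent_wrap_sym:
  assumes "u \<in> torus N" "adjacent (wrap N) u v" shows "adjacent (wrap N) v u"
proof -
  obtain e where e: "e \<in> unit_steps" "v = wrap N (u + e)" using assms by (auto simp: adjacent_def)
  have "wrap N (v + - e) = u" using assms(1) wrap_add_wrap[of N "u + e" "- e"]
    by (simp add: e wrap_torus)
  with uminus_unit_step[OF e(1)] show ?thesis unfolding adjacent_def by metis
qed

lemma component_eq:
  assumes "\<And>u v. u \<in> S \<Longrightarrow> v \<in> S \<Longrightarrow> adjacent r u v \<Longrightarrow> adjacent r v u"
    and "y \<in> component r S x"
  shows "component r S y = component r S x"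
proof -
  let ?E = "\<lambda>u v. u \<in> S \<and> v \<in> S \<and> adjacent r u v"
  have "symp ?E" using assms(1) by (auto simp: symp_def)
  then have "?E\<^sup>*\<^sup>* y x" using assms(2) unfolding component_def
    by (simp add: sympD symp_rtranclp)
  with assms(2) show ?thesis unfolding component_def mem_Collect_eq
    by (intro Collect_cong iffI) (rule rtranclp_trans, assumption+)+
qed

lemma component_subset: "y \<in> component r S x \<Longrightarrow> x \<in> S \<Longrightarrow> y \<in> S"
  unfolding component_def by (auto elim: rtranclp.cases)

lemma component_refl [simp]: "x \<in> component r S x"
  by (simp add: component_def)

lemma component_mono:
  assumes "S \<subseteq> T" shows "component r S x \<subseteq> component r T x"
proof -
  have "(\<lambda>u v. u \<in> S \<and> v \<in> S \<and> adjacent r u v) \<le> (\<lambda>u v. u \<in> T \<and> v \<in> T \<and> adjacent r u v)"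
    using assms by blast
  from rtranclp_mono[OF this] show ?thesis unfolding component_def by blast
qed

text \<open>
  A crossing of \<open>cube R\<close> is encoded by a vertex set that leads from the origin out of the cube. The
  restriction to \<open>cube (Suc R)\<close>, which a nearest-neighbour path reaches when it first leaves
  \<open>cube R\<close>, makes the family of these sets finite, so that \<open>crosses R\<close> of a level set is an increasing
  event of finitely many coordinates.
\<close>

definition crossing_sets :: "nat \<Rightarrow> (int ^ 'd::finite) set set" where
  "crossing_sets R = {K. K \<subseteq> cube (Suc R) \<and> 0 \<in> K \<and> \<not> component id K 0 \<subseteq> cube R}"

definition crosses :: "nat \<Rightarrow> (int ^ 'd::finite) set \<Rightarrow> bool" where
  "crosses R L \<longleftrightarrow> (\<exists>K\<in>crossing_sets R. K \<subseteq> L)"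

lemma finite_crossing_sets: "finite (crossing_sets R)"
  by (rule finite_subset[of _ "Pow (cube (Suc R))"]) (auto simp: crossing_sets_def)

lemma finite_crossing_set: "K \<in> crossing_sets R \<Longrightarrow> finite K"
  by (auto simp: crossing_sets_def intro: finite_subset[OF _ finite_cube])

lemma crosses_mono: "crosses R L \<Longrightarrow> L \<subseteq> L' \<Longrightarrow> crosses R L'"
  unfolding crosses_def by blast

text \<open>
  Before it leaves \<open>cube R\<close> for the first time, a path has only visited \<open>cube R\<close> and one more vertex of
  \<open>cube (Suc R)\<close>. Equivalently, if the component within \<open>L \<inter> cube (Suc R)\<close> stayed inside \<open>cube R\<close>, then
  every step of \<open>L\<close> out of it would still lie in \<open>L \<inter> cube (Suc R)\<close>, and it would be the whole
  component of the origin in \<open>L\<close>.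
\<close>

lemma component_escape_imp_crosses:
  assumes "0 \<in> L" "\<not> component id L 0 \<subseteq> cube R" shows "crosses R L"
proof -
  let ?K = "L \<inter> cube (Suc R)"
  have "\<not> component id ?K 0 \<subseteq> cube R"
  proof
    assume K: "component id ?K 0 \<subseteq> cube R"
    have "v \<in> component id ?K 0" if "v \<in> component id L 0" for v
      using that unfolding component_def mem_Collect_eq
    proof (induction rule: rtranclp_induct)
      case (step y z)
      have y: "y \<in> cube R" using step.IH K unfolding component_def by blast
      then have "y \<in> ?K" "z \<in> ?K" using step adjacent_cube_Suc[OF y] cube_mono[of R "Suc R"] by auto
      with step show ?case by (metis (no_types, lifting) rtranclp.rtrancl_into_rtrancl)
    qed simp
    with K assms(2) show False by blast
  qed
  with assms(1) show ?thesis unfolding crosses_def crossing_sets_def by (intro bexI[of _ ?K]) auto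
qed

lemma crosses_imp_component_escape:
  assumes "crosses R L" shows "0 \<in> L \<and> \<not> component id L 0 \<subseteq> cube R"
  using assms component_mono unfolding crosses_def crossing_sets_def by blast

lemma crosses_Suc: "crosses (Suc R) L \<Longrightarrow> crosses R L"
  using crosses_imp_component_escape[of "Suc R" L] component_escape_imp_crosses[of L R]
    cube_mono[of R "Suc R"] by auto

text \<open>
  A component is infinite exactly if no cube contains it. This writes percolation, an event of
  infinitely many coordinates, as a decreasing intersection of finite ones; it yields both the
  measurability of the event and the approximation of its probability.
\<close>

lemma percolates_iff: "percolates f h \<longleftrightarrow> (\<forall>R. crosses R (level_set UNIV f h))"
proof -
  let ?L = "level_set UNIV f h"
  have "percolates f h \<longleftrightarrow> 0 \<in> ?L \<and> infinite (component id ?L 0)"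
  proof
    assume "percolates f h"
    then obtain x where x: "x \<in> ?L" "0 \<in> component id ?L x" "infinite (component id ?L x)"
      unfolding percolates_def components_def by blast
    then show "0 \<in> ?L \<and> infinite (component id ?L 0)"
      using component_subset[OF x(2,1)] component_eq[OF adjacent_id_sym x(2)] by simp
  next
    assume "0 \<in> ?L \<and> infinite (component id ?L 0)"
    then show "percolates f h"
      unfolding percolates_def components_def by (intro bexI[of _ "component id ?L 0"]) auto
  qed
  also have "\<dots> \<longleftrightarrow> (\<forall>R. 0 \<in> ?L \<and> \<not> component id ?L 0 \<subseteq> cube R)"
    using finite_subset[OF _ finite_cube] finite_subset_cube by blast
  also have "\<dots> \<longleftrightarrow> (\<forall>R. crosses R ?L)"
    using crosses_imp_component_escape component_escape_imp_crosses by blast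
  finally show ?thesis .
qed

text \<open>
  Paths on the torus lift to paths on the lattice, so the lifted component covers the one on the torus
  under the projection \<open>v \<mapsto> wrap N (x + v)\<close>. A component with more vertices than \<open>cube R\<close> therefore
  has a lift that is not contained in \<open>cube R\<close>.
\<close>

lemma torus_large_component_crosses:
  assumes x: "x \<in> E" "E \<subseteq> torus N" 
    and large: "card (component (wrap N) E x) > card (cube R :: (int ^ 'd::finite) set)"
  shows "crosses R {v :: int ^ 'd. wrap N (x + v) \<in> E}"
proof -
  define L where "L = {v :: int ^ 'd. wrap N (x + v) \<in> E}"
  have L: "v \<in> L \<longleftrightarrow> wrap N (x + v) \<in> E" for v by (simp add: L_def)
  have wx: "wrap N x = x" using x wrap_torus by blast
  then have 0: "0 \<in> L" using x(1) by (simp add: L)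
  have "\<exists>v\<in>component id L 0. y = wrap N (x + v)" if "y \<in> component (wrap N) E x" for y
    using that unfolding component_def mem_Collect_eq
  proof (induction rule: rtranclp_induct)
    case base
    show ?case using wx by (intro bexI[of _ 0]) simp_all
  next
    case (step y z)
    from step.IH obtain v where v: "v \<in> component id L 0" "y = wrap N (x + v)"
      unfolding component_def by (elim bexE)
    obtain e where e: "e \<in> unit_steps" "z = wrap N (y + e)" 
      using step.hyps(2) unfolding adjacent_def by blast
    have z: "z = wrap N (x + (v + e))" unfolding e v wrap_add_wrap by (simp add: add.assoc)
    have "v \<in> L" "v + e \<in> L" using v(2) step.hyps(2) z by (simp_all add: L)
    moreover have "adjacent id v (v + e)" using e(1) by (auto simp: adjacent_def)
    ultimately have "v + e \<in> component id L 0"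
      using v(1) unfolding component_def mem_Collect_eq by (simp only: rtranclp.rtrancl_into_rtrancl)
    with z show ?case unfolding component_def by (rule bexI)
  qed
  then have sub: "component (wrap N) E x \<subseteq> (\<lambda>v. wrap N (x + v)) ` component id L 0"
    by blast
  have "\<not> component id L 0 \<subseteq> cube R"
  proof
    assume "component id L 0 \<subseteq> cube R"
    then have "component (wrap N) E x \<subseteq> (\<lambda>v. wrap N (x + v)) ` cube R"
      using sub by blast
    then have "card (component (wrap N) E x) \<le> card (cube R :: (int ^ 'd) set)"
      by (rule surj_card_le[rotated]) simp
    then show False using large by simp
  qed
  then show ?thesis using component_escape_imp_crosses[OF 0] unfolding L_def by simp
qed

lemma finite_torus [simp]: "finite (torus N)"
  by (rule finite_subset[OF _ finite_vec_interval[of 0 "int N"]]) (auto simp: torus_def less_imp_le)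

text \<open>
  Every vertex of the largest component sees that component as its own. This is what turns one event
  about the maximum into a count of vertices with a large component.
\<close>

lemma C_max_vertices:
  fixes f :: "int ^ 'd::finite \<Rightarrow> real"
  assumes "y \<in> C_max N f h"
  shows "y \<in> level_set (torus N) f h"
    and "component (wrap N) (level_set (torus N) f h) y = C_max N f h"
proof -
  let ?E = "level_set (torus N) f h"
  have E: "?E \<subseteq> torus N" by (auto simp: level_set_def)
  then have fin: "finite (components (wrap N) ?E)"
    unfolding components_def using finite_subset[OF E finite_torus] by blast
  have ne: "?E \<noteq> {}"
  proof
    assume "?E = {}"
    with assms show False by (simp add: C_max_def)
  qed
  then obtain C0 where "C0 \<in> components (wrap N) ?E" by (auto simp: components_def)
  then have "(ARG_MAX card C. C \<in> components (wrap N) ?E) \<in> components (wrap N) ?E"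
    by (rule arg_max_natI[where b = "Suc (Max (card ` components (wrap N) ?E))"])
      (simp add: less_Suc_eq_le fin)
  then have "C_max N f h \<in> components (wrap N) ?E" using ne by (simp add: C_max_def Let_def)
  then obtain x where x: "x \<in> ?E" "C_max N f h = component (wrap N) ?E x"
    by (auto simp: components_def)
  then show "y \<in> ?E" using assms component_subset by blast
  show "component (wrap N) ?E y = C_max N f h"
    unfolding x(2)
  proof (rule component_eq)
    show "adjacent (wrap N) v u" if "u \<in> ?E" "adjacent (wrap N) u v" for u v
      using adjacent_wrap_sym[of u N v] that E by blast
    show "y \<in> component (wrap N) ?E x" using assms x(2) by simp
  qed
qed

section \<open>Gaussian expectations of trigonometric polynomials\<close>

text \<open>
  The real part of the characteristic function of the normal law, rescaled from the standard one and
  multiplied by \<open>cis b\<close>.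
\<close>

lemma integral_cos_normal:
  assumes s: "s > 0"
  shows "(LINT z|density lborel (\<lambda>z. ennreal (normal_density 0 s z)). cos (z + b))
    = cos b * exp (- s\<^sup>2 / 2)"
proof -
  interpret N: prob_space "density lborel (\<lambda>z. ennreal (normal_density 0 s z))"
    using prob_space_normal_density[OF s] .
  let ?N = "density lborel (\<lambda>z. ennreal (normal_density 0 s z))"
  have "distributed ?N lborel (\<lambda>z. z) (normal_density 0 s)"
    unfolding distributed_def by (auto simp: distr_id2)
  then have "distributed ?N lborel (\<lambda>z. z / s) std_normal_density"
    using N.normal_standard_normal_convert[of s "\<lambda>z. z" 0] s by simp
  then have d: "distr ?N lborel (\<lambda>z. z / s) = std_normal_distribution"
    by (simp add: distributed_def)
  have "(LINT z|?N. cis (z + b)) = (LINT z|?N. cis (s * (z / s)) * cis b)"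
    using s by (simp add: cis_mult)
  also have "\<dots> = (LINT z|?N. cis (s * (z / s))) * cis b" by simp
  also have "(LINT z|?N. cis (s * (z / s))) = (LINT x|distr ?N lborel (\<lambda>z. z / s). iexp (s * x))"
    by (subst integral_distr) (auto simp: cis_conv_exp)
  also have "\<dots> = complex_of_real (exp (- (s\<^sup>2) / 2))"
    unfolding d using char_std_normal_distribution unfolding char_def by (simp add: fun_eq_iff)
  finally have c: "(LINT z|?N. cis (z + b)) = complex_of_real (exp (- (s\<^sup>2) / 2)) * cis b" .
  have "integrable ?N (\<lambda>z. cis (z + b))"
    by (rule N.integrable_const_bound[of _ 1]) (auto simp: cis_conv_exp)
  then have "(LINT z|?N. Re (cis (z + b))) = Re (LINT z|?N. cis (z + b))"
    by (rule integral_Re)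
  then show ?thesis unfolding c by (simp add: mult.commute)
qed

lemma gaussian_rv_integrable:
  assumes "gaussian_rv M Z" 
  shows "integrable M Z" "integrable M (\<lambda>\<omega>. (Z \<omega>)\<^sup>2)"
proof -
  from assms obtain m s where Z[measurable]: "Z \<in> borel_measurable M" and s: "s \<ge> 0" and
    d: "distr M borel Z = (if s = 0 then return borel m
           else density lborel (\<lambda>z. ennreal (normal_density m s z)))"
    unfolding gaussian_rv_def by blast
  have i: "integrable (distr M borel Z) (\<lambda>z. z) \<and> integrable (distr M borel Z) (\<lambda>z. z\<^sup>2)"
  proof (cases "s = 0")
    case True
    have r: "integrable (return borel m) f" if "f \<in> borel_measurable borel" for f :: "real \<Rightarrow> real"
    proof -
      interpret prob_space "return borel m" by (rule prob_space_return) simp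
      have "f \<in> borel_measurable (return borel m)" using that by simp
      then show ?thesis
        by (intro integrable_const_bound[of _ "norm (f m)"]) (simp_all add: AE_return)
    qed
    have "distr M borel Z = return borel m" using True d by simp
    moreover have "integrable (return borel m) (\<lambda>z. z)" by (rule r) measurable
    moreover have "integrable (return borel m) (\<lambda>z. z\<^sup>2)" by (rule r) measurable
    ultimately show ?thesis by (simp only: conj_assoc)
  next
    case False
    with s have s: "s > 0" by simp
    have 0: "integrable lborel (\<lambda>x. normal_density m s x * x)"
      by (rule integrable_normal_moment_nz_1[OF s])
    have "integrable lborel (\<lambda>x. normal_density m s x * (x - m)\<^sup>2 + 2 * m * (normal_density m s x * x) 
        - m\<^sup>2 * normal_density m s x)"
      using integrable_normal_moment[OF s, of m 2] 0 integrable_normal_density[OF s, of m] by auto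
    also have "(\<lambda>x. normal_density m s x * (x - m)\<^sup>2 + 2 * m * (normal_density m s x * x) 
        - m\<^sup>2 * normal_density m s x) = (\<lambda>x. normal_density m s x * x\<^sup>2)"
      by (auto simp: power2_eq_square algebra_simps)
    finally show ?thesis using 0 False by (simp add: d integrable_density)
  qed
  show "integrable M Z" "integrable M (\<lambda>\<omega>. (Z \<omega>)\<^sup>2)"
    using i by (simp_all add: integrable_distr_eq)
qed

lemma gaussian_rv_integral_cos:
  assumes "prob_space M" "gaussian_rv M Z" and mean: "(LINT \<omega>|M. Z \<omega>) = 0"
  shows "(LINT \<omega>|M. cos (Z \<omega> + b)) = cos b * exp (- (LINT \<omega>|M. (Z \<omega>)\<^sup>2) / 2)"
proof -
  from assms obtain m s where Z[measurable]: "Z \<in> borel_measurable M" and s: "s \<ge> 0" and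
    d: "distr M borel Z = (if s = 0 then return borel m
           else density lborel (\<lambda>z. ennreal (normal_density m s z)))"
    unfolding gaussian_rv_def by blast
  have tr: "(LINT \<omega>|M. f (Z \<omega>)) = (LINT z|distr M borel Z. f z)" 
    if [measurable]: "f \<in> borel_measurable borel" for f :: "real \<Rightarrow> real"
    by (simp add: integral_distr)
  show ?thesis
  proof (cases "s = 0")
    case True
    have "(LINT \<omega>|M. f (Z \<omega>)) = f m" if "f \<in> borel_measurable borel" for f :: "real \<Rightarrow> real"
      unfolding tr[OF that] d using that True by (simp add: integral_return)
    from this[of "\<lambda>x. x"] this[of "\<lambda>x. x\<^sup>2"] this[of "\<lambda>x. cos (x + b)"] mean show ?thesis by simp
  next
    case False
    with s have s: "s > 0" by simp
    have "m = 0" using mean tr[of "\<lambda>z. z"] integral_normal_moment_nz_1[OF s, of m] False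
      by (simp add: d integral_density)
    moreover have "(LINT \<omega>|M. (Z \<omega>)\<^sup>2) = s\<^sup>2"
      using \<open>m = 0\<close> tr[of "\<lambda>z. z\<^sup>2"] integral_normal_moment_even[OF s, of 0 1] False
      by (simp add: d integral_density)
    ultimately show ?thesis using tr[of "\<lambda>z. cos (z + b)"] integral_cos_normal[OF s, of b] False
      by (simp add: d)
  qed
qed

text \<open>
  The map \<open>p\<close> may identify points: the coefficients of a linear combination are then summed over the
  fibres of \<open>p\<close>. With \<open>p v = wrap N (x + v)\<close> this views the field on the torus as a Gaussian field on the
  whole lattice, periodic and centred at \<open>x\<close>.
\<close>

lemma centered_gaussian_field_reindex:
  assumes G: "centered_gaussian_field M V Z C" and p: "\<And>u. p u \<in> V"
  shows "centered_gaussian_field M UNIV (\<lambda>u. Z (p u)) (\<lambda>u v. C (p u) (p v))"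
proof -
  have gauss: "gaussian_rv M (\<lambda>\<omega>. \<Sum>x\<in>F. a x * Z x \<omega>)" if "finite F" "F \<subseteq> V" for F a
    using G that unfolding centered_gaussian_field_def by blast
  have "gaussian_rv M (\<lambda>\<omega>. \<Sum>u\<in>F. a u * Z (p u) \<omega>)" if F: "finite F" for F a
  proof -
    let ?b = "\<lambda>x. \<Sum>u | u \<in> F \<and> p u = x. a u"
    have "(\<Sum>u\<in>F. a u * Z (p u) \<omega>) = (\<Sum>x\<in>p ` F. ?b x * Z x \<omega>)" for \<omega>
    proof -
      have "(\<Sum>u\<in>F. a u * Z (p u) \<omega>) = (\<Sum>x\<in>p ` F. \<Sum>u | u \<in> F \<and> p u = x. a u * Z (p u) \<omega>)"
        using F by (rule sum.image_gen)
      then show ?thesis by (simp add: sum_distrib_right)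
    qed
    then have eq: "(\<lambda>\<omega>. \<Sum>u\<in>F. a u * Z (p u) \<omega>) = (\<lambda>\<omega>. \<Sum>x\<in>p ` F. ?b x * Z x \<omega>)"
      by (rule ext)
    have "finite (p ` F)" "p ` F \<subseteq> V" using F p by auto
    then show ?thesis unfolding eq by (rule gauss)
  qed
  with G p show ?thesis unfolding centered_gaussian_field_def by simp
qed

text \<open>
  Integrability of the products \<open>Z x * Z y\<close> is implicit in the definition of the field: the single
  variables are Gaussian, hence square integrable, and \<open>\<bar>u * v\<bar> \<le> u\<^sup>2 + v\<^sup>2\<close>.
\<close>

lemma centered_gaussian_field_sum:
  assumes G: "centered_gaussian_field M V Z C" and F: "finite F" "F \<subseteq> V"
  shows "gaussian_rv M (\<lambda>\<omega>. \<Sum>x\<in>F. a x * Z x \<omega>)"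
    and "(LINT \<omega>|M. (\<Sum>x\<in>F. a x * Z x \<omega>)) = 0"
    and "(LINT \<omega>|M. (\<Sum>x\<in>F. a x * Z x \<omega>)\<^sup>2) = (\<Sum>x\<in>F. \<Sum>y\<in>F. a x * a y * C x y)"
proof -
  have gauss: "gaussian_rv M (\<lambda>\<omega>. \<Sum>x\<in>F. a x * Z x \<omega>)" if "finite F" "F \<subseteq> V" for F a
    using G that unfolding centered_gaussian_field_def by blast
  show "gaussian_rv M (\<lambda>\<omega>. \<Sum>x\<in>F. a x * Z x \<omega>)" using F by (rule gauss)
  have g: "gaussian_rv M (\<lambda>\<omega>. Z x \<omega>)" if "x \<in> V" for x
  proof -
    have "gaussian_rv M (\<lambda>\<omega>. \<Sum>y\<in>{x}. 1 * Z y \<omega>)"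
      using that by (intro gauss) auto
    then show ?thesis by simp
  qed
  have int: "integrable M (Z x)" "integrable M (\<lambda>\<omega>. (Z x \<omega>)\<^sup>2)" "Z x \<in> borel_measurable M" if "x \<in> V" for x
    using gaussian_rv_integrable[OF g[OF that]] g[OF that] by (simp_all add: gaussian_rv_def)
  have int2: "integrable M (\<lambda>\<omega>. Z x \<omega> * Z y \<omega>)" if "x \<in> V" "y \<in> V" for x y
  proof (rule Bochner_Integration.integrable_bound)
    show "integrable M (\<lambda>\<omega>. (Z x \<omega>)\<^sup>2 + (Z y \<omega>)\<^sup>2)" using int(2) that by simp
    show "(\<lambda>\<omega>. Z x \<omega> * Z y \<omega>) \<in> borel_measurable M" using int(3) that by simp
    have "\<bar>u * v\<bar> \<le> u\<^sup>2 + v\<^sup>2" for u v :: real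
      using sum_squares_bound[of "\<bar>u\<bar>" "\<bar>v\<bar>"] mult_nonneg_nonneg[of "\<bar>u\<bar>" "\<bar>v\<bar>"]
      by (simp add: abs_mult del: mult_nonneg_nonneg)
    then show "AE \<omega> in M. norm (Z x \<omega> * Z y \<omega>) \<le> norm ((Z x \<omega>)\<^sup>2 + (Z y \<omega>)\<^sup>2)" by simp
  qed
  have m: "(LINT \<omega>|M. Z x \<omega>) = 0" if "x \<in> V" for x
    using G that unfolding centered_gaussian_field_def by blast
  have c: "(LINT \<omega>|M. Z x \<omega> * Z y \<omega>) = C x y" if "x \<in> V" "y \<in> V" for x y
    using G that unfolding centered_gaussian_field_def by blast
  have p: "x \<in> V" if "x \<in> F" for x using that F(2) by blast
  have "(LINT \<omega>|M. (\<Sum>x\<in>F. a x * Z x \<omega>)) = (\<Sum>x\<in>F. LINT \<omega>|M. a x * Z x \<omega>)"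
    by (rule Bochner_Integration.integral_sum) (simp add: int p)
  also have "\<dots> = 0" by (simp add: m p)
  finally show "(LINT \<omega>|M. (\<Sum>x\<in>F. a x * Z x \<omega>)) = 0" .
  have i: "integrable M (\<lambda>\<omega>. a x * a y * (Z x \<omega> * Z y \<omega>))" if "x \<in> F" "y \<in> F" for x y
    using int2[OF p[OF that(1)] p[OF that(2)]] by simp
  have "(LINT \<omega>|M. (\<Sum>x\<in>F. a x * Z x \<omega>)\<^sup>2)
      = (LINT \<omega>|M. (\<Sum>x\<in>F. \<Sum>y\<in>F. a x * a y * (Z x \<omega> * Z y \<omega>)))"
    by (simp add: power2_eq_square sum_product mult_ac)
  also have "\<dots> = (\<Sum>x\<in>F. LINT \<omega>|M. (\<Sum>y\<in>F. a x * a y * (Z x \<omega> * Z y \<omega>)))"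
    by (intro Bochner_Integration.integral_sum Bochner_Integration.integrable_sum i)
  also have "\<dots> = (\<Sum>x\<in>F. \<Sum>y\<in>F. LINT \<omega>|M. a x * a y * (Z x \<omega> * Z y \<omega>))"
    by (intro sum.cong refl Bochner_Integration.integral_sum i)
  also have "\<dots> = (\<Sum>x\<in>F. \<Sum>y\<in>F. a x * a y * C x y)"
    by (intro sum.cong refl) (simp add: c p)
  finally show "(LINT \<omega>|M. (\<Sum>x\<in>F. a x * Z x \<omega>)\<^sup>2) = (\<Sum>x\<in>F. \<Sum>y\<in>F. a x * a y * C x y)" .
qed

lemma centered_gaussian_field_single:
  assumes G: "centered_gaussian_field M V Z C" and x: "x \<in> V"
  shows "Z x \<in> borel_measurable M" "integrable M (\<lambda>\<omega>. (Z x \<omega>)\<^sup>2)"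
    and "(LINT \<omega>|M. (Z x \<omega>)\<^sup>2) = C x x"
proof -
  have g: "gaussian_rv M (\<lambda>\<omega>. Z x \<omega>)"
    using centered_gaussian_field_sum(1)[OF G, of "{x}" "\<lambda>_. 1"] x by simp
  show "Z x \<in> borel_measurable M" "integrable M (\<lambda>\<omega>. (Z x \<omega>)\<^sup>2)"
    using gaussian_rv_integrable[OF g] g by (simp_all add: gaussian_rv_def)
  show "(LINT \<omega>|M. (Z x \<omega>)\<^sup>2) = C x x"
    using centered_gaussian_field_sum(3)[OF G, of "{x}" "\<lambda>_. 1"] x by simp
qed

lemma centered_gaussian_field_cos:
  assumes G: "centered_gaussian_field M V Z C" and F: "finite F" "F \<subseteq> V"
  shows "(LINT \<omega>|M. cos ((\<Sum>x\<in>F. a x * Z x \<omega>) + b))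
    = cos b * exp (- (\<Sum>x\<in>F. \<Sum>y\<in>F. a x * a y * C x y) / 2)"
proof -
  have "prob_space M" using G by (simp add: centered_gaussian_field_def)
  from gaussian_rv_integral_cos[OF this centered_gaussian_field_sum(1,2)[OF G F, where a = a], of b]
  show ?thesis unfolding centered_gaussian_field_sum(3)[OF G F] .
qed

text \<open>
  The phase \<open>b\<close> accounts for the sines. The expectation of a trigonometric polynomial of a Gaussian
  field is an explicit continuous function of its covariance.
\<close>

inductive_set trig_polynomials :: "(('v \<Rightarrow> real) \<Rightarrow> real) set" where
  cosine: "finite I \<Longrightarrow> (\<lambda>x. c * cos ((\<Sum>v\<in>I. a v * x v) + b)) \<in> trig_polynomials"
| add: "f \<in> trig_polynomials \<Longrightarrow> g \<in> trig_polynomials \<Longrightarrow> (\<lambda>x. f x + g x) \<in> trig_polynomials"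

lemma cosine_mult:
  assumes "finite I" "finite J"
  shows "(\<lambda>x. (c * cos ((\<Sum>v\<in>I. a v * x v) + b)) * (c' * cos ((\<Sum>v\<in>J. a' v * x v) + b')))
     \<in> trig_polynomials"
proof -
  let ?e = "\<lambda>v. if v \<in> I then a v else 0" and ?e' = "\<lambda>v. if v \<in> J then a' v else 0"
  have I: "(\<Sum>v\<in>I. a v * x v) = (\<Sum>v\<in>I \<union> J. ?e v * x v)" for x :: "'a \<Rightarrow> real"
    using assms by (intro sum.mono_neutral_cong_left) auto
  have J: "(\<Sum>v\<in>J. a' v * x v) = (\<Sum>v\<in>I \<union> J. ?e' v * x v)" for x :: "'a \<Rightarrow> real"
    using assms by (intro sum.mono_neutral_cong_left) auto
  have "(\<lambda>x. c * c' / 2 * cos ((\<Sum>v\<in>I \<union> J. (?e v - ?e' v) * x v) + (b - b')) 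
     + c * c' / 2 * cos ((\<Sum>v\<in>I \<union> J. (?e v + ?e' v) * x v) + (b + b'))) \<in> trig_polynomials"
    using assms by (intro trig_polynomials.intros) simp_all
  moreover have "c * c' / 2 * cos (A - B + (b - b')) + c * c' / 2 * cos (A + B + (b + b'))
      = (c * cos (A + b)) * (c' * cos (B + b'))" for A B
  proof -
    have "A - B + (b - b') = (A + b) - (B + b')" "A + B + (b + b') = (A + b) + (B + b')" by simp_all
    then show ?thesis by (simp only: cos_add[of "A + b"] cos_diff[of "A + b"]) (simp add: field_simps)
  qed
  ultimately show ?thesis
    unfolding I J left_diff_distrib distrib_right sum_subtractf sum.distrib by simp
qed

lemma trig_polynomials_mult:
  assumes "f \<in> trig_polynomials" "g \<in> trig_polynomials"
  shows "(\<lambda>x. f x * g x) \<in> trig_polynomials"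
  using assms
proof (induction f)
  case (cosine I c a b)
  show ?case using \<open>g \<in> trig_polynomials\<close>
  proof (induction g)
    case (cosine J c' a' b')
    then show ?case using cosine_mult \<open>finite I\<close> by blast
  next
    case (add f g)
    then show ?case unfolding distrib_left by (intro trig_polynomials.add)
  qed
next
  case (add f g)
  then show ?case unfolding distrib_right by (intro trig_polynomials.add) simp_all
qed


lemma trig_polynomials_bounded:
  "f \<in> trig_polynomials \<Longrightarrow> \<exists>B. \<forall>x. \<bar>f x\<bar> \<le> B"
proof (induction rule: trig_polynomials.induct)
  case (cosine I c a b)
  have "\<bar>c * cos y\<bar> \<le> \<bar>c\<bar>" for y :: real
    using mult_left_mono[OF abs_cos_le_one, of "\<bar>c\<bar>" y] by (simp add: abs_mult)
  then show ?case by blast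
next
  case (add f g)
  then obtain B B' where "\<bar>f x\<bar> \<le> B" "\<bar>g x\<bar> \<le> B'" for x by blast
  then have "\<bar>f x + g x\<bar> \<le> B + B'" for x by (intro order_trans[OF abs_triangle_ineq] add_mono)
  then show ?case by blast
qed

lemma trig_polynomials_integrable:
  assumes "prob_space M" "f \<in> trig_polynomials" "\<And>v. X v \<in> borel_measurable M"
  shows "integrable M (\<lambda>\<omega>. f (\<lambda>v. X v \<omega>))"
proof -
  interpret prob_space M by fact
  obtain B where "\<And>x. \<bar>f x\<bar> \<le> B" using trig_polynomials_bounded[OF assms(2)] by blast
  moreover have "(\<lambda>\<omega>. f (\<lambda>v. X v \<omega>)) \<in> borel_measurable M"
    using assms(2)
  proof (induction rule: trig_polynomials.induct)
    case (cosine I c a b)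
    note assms(3)[measurable]
    show ?case by measurable
  next
    case (add f g)
    note add.IH[measurable]
    show ?case by measurable
  qed
  ultimately show ?thesis by (intro integrable_const_bound[of _ B]) auto
qed

text \<open>
  Measurability of the increasing events used below: some set of a finite family of finite sets lies in
  the level set.
\<close>

lemma sets_increasing_event:
  assumes "finite \<K>" and fin: "\<And>A. A \<in> \<K> \<Longrightarrow> finite A"
    and Y: "\<And>v. Y v \<in> borel_measurable N"
  shows "{\<omega> \<in> space N. \<exists>A\<in>\<K>. \<forall>v\<in>A. Y v \<omega> \<ge> (a :: real)} \<in> sets N"
proof -
  note Y[measurable]
  have "{\<omega> \<in> space N. \<forall>v\<in>A. Y v \<omega> \<ge> a} \<in> sets N" if "A \<in> \<K>" for A
    using fin[OF that] by measurable
  then have "(\<Union>A\<in>\<K>. {\<omega> \<in> space N. \<forall>v\<in>A. Y v \<omega> \<ge> a}) \<in> sets N"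
    using \<open>finite \<K>\<close> by (intro sets.finite_UN) auto
  also have "(\<Union>A\<in>\<K>. {\<omega> \<in> space N. \<forall>v\<in>A. Y v \<omega> \<ge> a})
      = {\<omega> \<in> space N. \<exists>A\<in>\<K>. \<forall>v\<in>A. Y v \<omega> \<ge> a}"
    by auto
  finally show ?thesis .
qed

text \<open>
  Convergence of covariances implies convergence in law of finitely many coordinates. The index set is
  countable so that the functions on it form a Hausdorff space on which the Stone--Weierstrass theorem
  is available.
\<close>

context
  fixes M :: "nat \<Rightarrow> 'a measure" and X :: "nat \<Rightarrow> 'v::countable \<Rightarrow> 'a \<Rightarrow> real" and K :: "nat \<Rightarrow> 'v \<Rightarrow> 'v \<Rightarrow> real"
    and P :: "'b measure" and \<phi> :: "'v \<Rightarrow> 'b \<Rightarrow> real" and D :: "'v \<Rightarrow> 'v \<Rightarrow> real"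
  assumes field: "\<And>n. centered_gaussian_field (M n) UNIV (X n) (K n)"
    and limit_field: "centered_gaussian_field P UNIV \<phi> D"
    and covariance: "\<And>u v. (\<lambda>n. K n u v) \<longlonglongrightarrow> D u v"
begin

lemma prob_spaces: "prob_space (M n)" "prob_space P"
  using field limit_field unfolding centered_gaussian_field_def by blast+

lemma trig_polynomials_convergence:
  assumes "f \<in> trig_polynomials"
  shows "(\<lambda>n. LINT \<omega>|M n. f (\<lambda>v. X n v \<omega>)) \<longlonglongrightarrow> (LINT \<omega>|P. f (\<lambda>v. \<phi> v \<omega>))"
  using assms
proof (induction rule: trig_polynomials.induct)
  case (cosine I c a b)
  have "(\<lambda>n. c * (cos b * exp (- (\<Sum>x\<in>I. \<Sum>y\<in>I. a x * a y * K n x y) / 2)))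
     \<longlonglongrightarrow> c * (cos b * exp (- (\<Sum>x\<in>I. \<Sum>y\<in>I. a x * a y * D x y) / 2))"
    by (intro tendsto_intros covariance) simp
  then show ?case
    using cosine by (simp add: centered_gaussian_field_cos[OF field] centered_gaussian_field_cos[OF limit_field])
next
  case (add f g)
  have i: "integrable (M n) (\<lambda>\<omega>. f (\<lambda>v. X n v \<omega>))" "integrable (M n) (\<lambda>\<omega>. g (\<lambda>v. X n v \<omega>))"
    "integrable P (\<lambda>\<omega>. f (\<lambda>v. \<phi> v \<omega>))" "integrable P (\<lambda>\<omega>. g (\<lambda>v. \<phi> v \<omega>))" for n
    by (rule trig_polynomials_integrable[OF _ _ centered_gaussian_field_single(1)[OF _ UNIV_I]],
        rule prob_spaces add.hyps field limit_field, rule add.hyps, rule field limit_field)+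
  have "(LINT \<omega>|M n. f (\<lambda>v. X n v \<omega>) + g (\<lambda>v. X n v \<omega>))
      = (LINT \<omega>|M n. f (\<lambda>v. X n v \<omega>)) + (LINT \<omega>|M n. g (\<lambda>v. X n v \<omega>))" for n
    by (rule Bochner_Integration.integral_add[OF i(1,2)])
  moreover have "(LINT \<omega>|P. f (\<lambda>v. \<phi> v \<omega>) + g (\<lambda>v. \<phi> v \<omega>))
      = (LINT \<omega>|P. f (\<lambda>v. \<phi> v \<omega>)) + (LINT \<omega>|P. g (\<lambda>v. \<phi> v \<omega>))"
    by (rule Bochner_Integration.integral_add[OF i(3,4)])
  ultimately show ?case using tendsto_add[OF add.IH] by (simp only:)
qed

text \<open>
  Approximation of \<open>f\<close> by a trigonometric polynomial that is bounded on the whole space. Put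
  \<open>F u = f (L * arcsin u)\<close> coordinatewise on the cube \<open>[-1, 1]\<^sup>V\<close>, which is compact by Tychonoff, and let \<open>g\<close>
  approximate \<open>F\<close> uniformly within \<open>\<epsilon>\<close>, by Stone--Weierstrass in the ring of those functions that become
  trigonometric polynomials after the substitution \<open>u = sin (x / L)\<close>. Then \<open>T x = g (sin (x / L))\<close> is
  within \<open>1 + \<epsilon>\<close> of \<open>f\<close> everywhere, and within \<open>\<epsilon>\<close> where the relevant coordinates are at most \<open>L\<close> in
  modulus, since there \<open>arcsin\<close> undoes the sine. The exceptional set has small probability uniformly in
  \<open>n\<close> because the variances converge.
\<close>

lemma continuous_expectation_convergence:
  fixes f :: "('v \<Rightarrow> real) \<Rightarrow> real"
  assumes f01: "\<And>x. 0 \<le> f x \<and> f x \<le> 1" and cont: "continuous_on UNIV f"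
    and fin: "finite V" and dep: "\<And>x y. (\<And>v. v \<in> V \<Longrightarrow> x v = y v) \<Longrightarrow> f x = f y"
    and meas: "\<And>n. (\<lambda>\<omega>. f (\<lambda>v. X n v \<omega>)) \<in> borel_measurable (M n)"
      "(\<lambda>\<omega>. f (\<lambda>v. \<phi> v \<omega>)) \<in> borel_measurable P"
  shows "(\<lambda>n. LINT \<omega>|M n. f (\<lambda>v. X n v \<omega>)) \<longlonglongrightarrow> (LINT \<omega>|P. f (\<lambda>v. \<phi> v \<omega>))"
proof (rule LIMSEQ_I)
  fix r :: real assume "r > 0"
  define \<epsilon> where "\<epsilon> = r / 5"
  have \<epsilon>: "\<epsilon> > 0" using \<open>r > 0\<close> by (simp add: \<epsilon>_def)
  \<comment> \<open>The scale is chosen so large that the second moments contribute at most \<open>\<epsilon>\<close> to the error.\<close>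
  define L where "L = max 1 (2 * (\<Sum>v\<in>V. D v v + 1) / \<epsilon>)"
  have L1: "L \<ge> 1" by (simp add: L_def)
  have "2 * (\<Sum>v\<in>V. D v v + 1) \<le> \<epsilon> * L"
    using \<epsilon> by (simp add: L_def field_simps max_def)
  also have "\<dots> \<le> \<epsilon> * L\<^sup>2" using L1 \<epsilon> by (simp add: power2_eq_square)
  finally have L: "2 * (\<Sum>v\<in>V. D v v + 1) / L\<^sup>2 \<le> \<epsilon>" using L1 by (simp add: field_simps)
  define S :: "('v \<Rightarrow> real) set" where "S = {u. \<forall>v. u v \<in> {-1..1}}"
  define s where "s x = (\<lambda>v. sin (x v / L))" for x :: "'v \<Rightarrow> real"
  define R where "R = {g. continuous_on S g \<and> (\<lambda>x. g (s x)) \<in> trig_polynomials}"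
  have s: "s x \<in> S" for x by (simp add: s_def S_def)
  have coord: "continuous_on S (\<lambda>u. u v)" for v
    by (rule continuous_on_subset[OF continuous_on_product_coordinates subset_UNIV])
  interpret function_ring_on R S
  proof
    have "S = PiE UNIV (\<lambda>_. {-1..1})" by (auto simp: S_def)
    moreover have "compactin (product_topology (\<lambda>_. euclidean) UNIV) (PiE UNIV (\<lambda>_ :: 'v. {-1..1 :: real}))"
      unfolding compactin_PiE by simp
    ultimately show "compact S" by (simp add: euclidean_product_topology)
    show "(\<lambda>_. c) \<in> R" for c
      using trig_polynomials.cosine[of "{}" c _ 0] by (simp add: R_def)
    show "(\<lambda>x. f x * g x) \<in> R" if "f \<in> R" "g \<in> R" for f g
      using that trig_polynomials_mult[of "\<lambda>x. f (s x)" "\<lambda>x. g (s x)"]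
      by (simp add: R_def continuous_on_mult)
    show "(\<lambda>x. f x + g x) \<in> R" if "f \<in> R" "g \<in> R" for f g
      using that trig_polynomials.add[of "\<lambda>x. f (s x)" "\<lambda>x. g (s x)"]
      by (simp add: R_def continuous_on_add)
    show "\<exists>f\<in>R. f x \<noteq> f y" if "x \<noteq> y" for x y
    proof -
      have "\<exists>v. x v \<noteq> y v" using that by (simp add: fun_eq_iff)
      then obtain v where v: "x v \<noteq> y v" by (elim exE)
      have "(\<lambda>x. s x v) \<in> trig_polynomials"
        using trig_polynomials.cosine[of "{v}" 1 "\<lambda>_. 1 / L" "- pi / 2"]
        by (simp add: s_def cos_diff)
      then have "(\<lambda>u. u v) \<in> R" using coord by (simp add: R_def)
      with v show ?thesis by (intro bexI[of _ "\<lambda>u. u v"])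
    qed
  qed (simp add: R_def)
  define F where "F u = f (\<lambda>v. L * arcsin (u v))" for u
  have "continuous_on S (\<lambda>u v. L * arcsin (u v))"
    using coord by (intro continuous_on_coordinatewise_then_product continuous_intros) (auto simp: S_def)
  then have "continuous_on S F"
    unfolding F_def by (rule continuous_on_compose2[OF cont]) simp
  from Stone_Weierstrass_basic[OF this \<epsilon>] obtain g where g: "g \<in> R" "\<And>u. u \<in> S \<Longrightarrow> \<bar>F u - g u\<bar> < \<epsilon>"
    by blast
  define T where "T x = g (s x)" for x
  have T: "T \<in> trig_polynomials" using g(1) by (simp add: R_def T_def[abs_def])
  \<comment> \<open>A pointwise form of Chebyshev's inequality: if some coordinate exceeds \<open>L\<close>, the last term
    is at least \<open>2\<close>.\<close>
  have close: "\<bar>f x - T x\<bar> \<le> \<epsilon> + 2 / L\<^sup>2 * (\<Sum>v\<in>V. (x v)\<^sup>2)" for x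
  proof (cases "\<forall>v\<in>V. \<bar>x v\<bar> \<le> L")
    case True
    have "L * arcsin (s x v) = x v" if "v \<in> V" for v
    proof -
      have "\<bar>x v / L\<bar> \<le> 1" using True that L1 by (simp add: abs_divide)
      then have "\<bar>x v / L\<bar> \<le> pi / 2" using pi_gt3 by linarith
      then have "arcsin (sin (x v / L)) = x v / L" by (intro arcsin_sin) (simp_all only: abs_le_iff, linarith+)
      then show ?thesis unfolding s_def using L1 by simp
    qed
    then have "F (s x) = f x" unfolding F_def by (rule dep)
    then have "\<bar>f x - T x\<bar> < \<epsilon>" using g(2)[OF s, of x] by (simp add: T_def)
    moreover have "2 / L\<^sup>2 * (\<Sum>v\<in>V. (x v)\<^sup>2) \<ge> 0" by (intro mult_nonneg_nonneg sum_nonneg) auto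
    ultimately show ?thesis by linarith
  next
    case False
    then obtain v where v: "v \<in> V" "\<bar>x v\<bar> > L" by force
    then have "L\<^sup>2 \<le> (x v)\<^sup>2" using L1 by (simp add: abs_le_square_iff[symmetric])
    also have "\<dots> \<le> (\<Sum>v\<in>V. (x v)\<^sup>2)" using v fin by (intro member_le_sum) auto
    finally have "2 \<le> 2 / L\<^sup>2 * (\<Sum>v\<in>V. (x v)\<^sup>2)" using L1 by (simp add: field_simps)
    moreover have "\<bar>f x - F (s x)\<bar> \<le> 1" using f01[of x] f01[of "\<lambda>v. L * arcsin (s x v)"] 
      unfolding F_def abs_le_iff by linarith
    moreover have "\<bar>F (s x) - T x\<bar> < \<epsilon>" using g(2)[OF s, of x] by (simp add: T_def)
    ultimately show ?thesis by linarith
  qed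
  have comp: "\<bar>(LINT \<omega>|N. f (\<lambda>v. Y v \<omega>)) - (LINT \<omega>|N. T (\<lambda>v. Y v \<omega>))\<bar> \<le> 2 * \<epsilon>"
    if G: "centered_gaussian_field N UNIV Y C" and C: "\<And>v. v \<in> V \<Longrightarrow> C v v \<le> D v v + 1"
    and m: "(\<lambda>\<omega>. f (\<lambda>v. Y v \<omega>)) \<in> borel_measurable N" for N :: "'z measure" and Y C
  proof -
    interpret N: prob_space N using G by (simp add: centered_gaussian_field_def)
    note Y = centered_gaussian_field_single[OF G UNIV_I]
    have i: "integrable N (\<lambda>\<omega>. f (\<lambda>v. Y v \<omega>))"
      using f01 by (intro N.integrable_const_bound[of _ 1] m) simp
    have j: "integrable N (\<lambda>\<omega>. T (\<lambda>v. Y v \<omega>))"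
      using Y(1) by (intro trig_polynomials_integrable N.prob_space_axioms T)
    have "\<bar>(LINT \<omega>|N. f (\<lambda>v. Y v \<omega>)) - (LINT \<omega>|N. T (\<lambda>v. Y v \<omega>))\<bar>
       = \<bar>LINT \<omega>|N. f (\<lambda>v. Y v \<omega>) - T (\<lambda>v. Y v \<omega>)\<bar>" using i j by simp
    also have "\<dots> \<le> (LINT \<omega>|N. \<bar>f (\<lambda>v. Y v \<omega>) - T (\<lambda>v. Y v \<omega>)\<bar>)" by (rule integral_abs_bound)
    also have "\<dots> \<le> (LINT \<omega>|N. \<epsilon> + 2 / L\<^sup>2 * (\<Sum>v\<in>V. (Y v \<omega>)\<^sup>2))"
      using i j Y(2) by (intro integral_mono close) auto
    also have "\<dots> = \<epsilon> + 2 / L\<^sup>2 * (\<Sum>v\<in>V. C v v)" using Y(2,3) by (simp add: N.prob_space)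
    also have "\<dots> \<le> \<epsilon> + 2 / L\<^sup>2 * (\<Sum>v\<in>V. D v v + 1)"
      using C by (intro add_left_mono mult_left_mono sum_mono) auto
    finally show ?thesis using L by simp
  qed
  have "\<forall>\<^sub>F n in sequentially. \<forall>v\<in>V. K n v v \<le> D v v + 1"
  proof (intro eventually_ball_finite fin ballI)
    show "\<forall>\<^sub>F n in sequentially. K n v v \<le> D v v + 1" for v
      using order_tendstoD(2)[OF covariance, of v v "D v v + 1"]
      by (auto elim!: eventually_mono)
  qed
  moreover have "\<forall>\<^sub>F n in sequentially. \<bar>(LINT \<omega>|M n. T (\<lambda>v. X n v \<omega>)) - (LINT \<omega>|P. T (\<lambda>v. \<phi> v \<omega>))\<bar> < \<epsilon>"
    using tendstoD[OF trig_polynomials_convergence[OF T] \<epsilon>] by (simp add: dist_real_def)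
  ultimately have "\<forall>\<^sub>F n in sequentially. norm ((LINT \<omega>|M n. f (\<lambda>v. X n v \<omega>)) - (LINT \<omega>|P. f (\<lambda>v. \<phi> v \<omega>))) < r"
  proof eventually_elim
    case (elim n)
    have "\<bar>(LINT \<omega>|M n. f (\<lambda>v. X n v \<omega>)) - (LINT \<omega>|M n. T (\<lambda>v. X n v \<omega>))\<bar> \<le> 2 * \<epsilon>"
      using elim(1) by (intro comp[OF field] meas) auto
    moreover have "\<bar>(LINT \<omega>|P. f (\<lambda>v. \<phi> v \<omega>)) - (LINT \<omega>|P. T (\<lambda>v. \<phi> v \<omega>))\<bar> \<le> 2 * \<epsilon>"
      by (intro comp[OF limit_field] meas) auto
    ultimately show ?case using elim(2) \<epsilon> unfolding \<epsilon>_def real_norm_def by (simp add: abs_if split: if_splits)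
  qed
  then show "\<exists>no. \<forall>n\<ge>no. norm ((LINT \<omega>|M n. f (\<lambda>v. X n v \<omega>)) - (LINT \<omega>|P. f (\<lambda>v. \<phi> v \<omega>))) < r"
    unfolding eventually_sequentially .
qed

text \<open>
  One half of the portmanteau theorem. Lowering the level from \<open>h\<close> to \<open>h'\<close> leaves room for a continuous
  function \<open>f\<close> between the indicators of the two events: with \<open>c\<close> the linear ramp from \<open>0\<close> at \<open>h'\<close> to \<open>1\<close>
  at \<open>h\<close>, take \<open>f x = 1 - (\<Prod>A\<in>\<K>. 1 - (\<Prod>v\<in>A. c (x v)))\<close>.
\<close>

lemma increasing_event_limit:
  assumes fin: "finite \<K>" "\<And>A. A \<in> \<K> \<Longrightarrow> finite A" and h: "h' < h" and \<epsilon>: "\<epsilon> > 0"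
  shows "\<forall>\<^sub>F n in sequentially.
    \<P>(\<omega> in M n. \<exists>A\<in>\<K>. \<forall>v\<in>A. X n v \<omega> \<ge> h) < \<P>(\<omega> in P. \<exists>A\<in>\<K>. \<forall>v\<in>A. \<phi> v \<omega> \<ge> h') + \<epsilon>"
proof -
  define c where "c t = max 0 (min 1 ((t - h') / (h - h')))" for t
  define f where "f x = 1 - (\<Prod>A\<in>\<K>. 1 - (\<Prod>v\<in>A. c (x v)))" for x :: "'v \<Rightarrow> real"
  have c01: "0 \<le> c t" "c t \<le> 1" for t by (simp_all add: c_def)
  have A01: "0 \<le> 1 - (\<Prod>v\<in>A. c (x v))" "1 - (\<Prod>v\<in>A. c (x v)) \<le> 1" for A and x :: "'v \<Rightarrow> real"
    using c01 by (simp_all add: prod_le_1 prod_nonneg)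
  have f01: "0 \<le> f x" "f x \<le> 1" for x
    unfolding f_def using prod_le_1[of \<K> "\<lambda>A. 1 - (\<Prod>v\<in>A. c (x v))"]
      prod_nonneg[of \<K> "\<lambda>A. 1 - (\<Prod>v\<in>A. c (x v))"] A01 by simp_all
  have f1: "f x = 1" if "A \<in> \<K>" "\<forall>v\<in>A. x v \<ge> h" for A x
  proof -
    have "c (x v) = 1" if "v \<in> A" for v
      using \<open>\<forall>v\<in>A. x v \<ge> h\<close> that h by (simp add: c_def field_simps)
    then have "1 - (\<Prod>v\<in>A. c (x v)) = 0" by simp
    then have "(\<Prod>A\<in>\<K>. 1 - (\<Prod>v\<in>A. c (x v))) = 0" using fin \<open>A \<in> \<K>\<close> by (intro prod_zero) auto
    then show ?thesis by (simp add: f_def)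
  qed
  have f0: "f x = 0" if n: "\<not> (\<exists>A\<in>\<K>. \<forall>v\<in>A. x v \<ge> h')" for x
  proof -
    have "(\<Prod>v\<in>A. c (x v)) = 0" if A: "A \<in> \<K>" for A
    proof -
      obtain v where v: "v \<in> A" "x v < h'" using n A by force
      then have "(x v - h') / (h - h') < 0" using h by (intro divide_neg_pos) auto
      then have "c (x v) = 0" by (simp add: c_def)
      with v show ?thesis using fin(2)[OF A] by (intro prod_zero) auto
    qed
    then show ?thesis by (simp add: f_def)
  qed
  have c_cont: "continuous_on UNIV c"
    unfolding c_def using h by (intro continuous_intros) simp
  have [measurable]: "c \<in> borel_measurable borel"
    using c_cont by (rule borel_measurable_continuous_onI)
  have meas: "(\<lambda>\<omega>. f (\<lambda>v. Y v \<omega>)) \<in> borel_measurable N"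
    if [measurable]: "\<And>v. Y v \<in> borel_measurable N" for N :: "'z measure" and Y
    unfolding f_def by measurable
  have sets: "{\<omega> \<in> space N. \<exists>A\<in>\<K>. \<forall>v\<in>A. Y v \<omega> \<ge> a} \<in> sets N"
    if "\<And>v. Y v \<in> borel_measurable N" for N :: "'z measure" and Y and a :: real
    using fin that by (rule sets_increasing_event)
  have X: "X n v \<in> borel_measurable (M n)" "\<phi> v \<in> borel_measurable P" for n v
    using centered_gaussian_field_single(1)[OF field UNIV_I]
      centered_gaussian_field_single(1)[OF limit_field UNIV_I] by simp_all
  have "continuous_on UNIV (\<lambda>x :: 'v \<Rightarrow> real. c (x v))" for v
    by (rule continuous_on_compose2[OF c_cont continuous_on_product_coordinates]) simp
  then have cont: "continuous_on UNIV f"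
    unfolding f_def by (intro continuous_intros)
  have "(\<lambda>n. LINT \<omega>|M n. f (\<lambda>v. X n v \<omega>)) \<longlonglongrightarrow> (LINT \<omega>|P. f (\<lambda>v. \<phi> v \<omega>))"
  proof (rule continuous_expectation_convergence)
    show "finite (\<Union>\<K>)" using fin by blast
    show "f x = f y" if eq: "\<And>v. v \<in> \<Union>\<K> \<Longrightarrow> x v = y v" for x y
    proof -
      have "(\<Prod>v\<in>A. c (x v)) = (\<Prod>v\<in>A. c (y v))" if "A \<in> \<K>" for A
        using eq that by (intro prod.cong refl arg_cong[of _ _ c]) blast
      then show ?thesis unfolding f_def by simp
    qed
    show "(\<lambda>\<omega>. f (\<lambda>v. X n v \<omega>)) \<in> borel_measurable (M n)" for n
      using X(1) by (rule meas)
    show "(\<lambda>\<omega>. f (\<lambda>v. \<phi> v \<omega>)) \<in> borel_measurable P"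
      using X(2) by (rule meas)
    show "0 \<le> f x \<and> f x \<le> 1" for x using f01 by blast
  qed (rule cont)
  from order_tendstoD(2)[OF this, of "(LINT \<omega>|P. f (\<lambda>v. \<phi> v \<omega>)) + \<epsilon>"]
  have "\<forall>\<^sub>F n in sequentially. (LINT \<omega>|M n. f (\<lambda>v. X n v \<omega>)) < (LINT \<omega>|P. f (\<lambda>v. \<phi> v \<omega>)) + \<epsilon>"
    using \<epsilon> by simp
  moreover have "\<P>(\<omega> in M n. \<exists>A\<in>\<K>. \<forall>v\<in>A. X n v \<omega> \<ge> h) \<le> (LINT \<omega>|M n. f (\<lambda>v. X n v \<omega>))" for n
  proof -
    interpret prob_space "M n" by (rule prob_spaces)
    have "\<P>(\<omega> in M n. \<exists>A\<in>\<K>. \<forall>v\<in>A. X n v \<omega> \<ge> h)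
      = (LINT \<omega>|M n. indicator {\<omega> \<in> space (M n). \<exists>A\<in>\<K>. \<forall>v\<in>A. X n v \<omega> \<ge> h} \<omega>)"
      using sets[OF X(1)] by simp
    also have "\<dots> \<le> (LINT \<omega>|M n. f (\<lambda>v. X n v \<omega>))"
    proof (rule integral_mono)
      show "integrable (M n) (\<lambda>\<omega>. f (\<lambda>v. X n v \<omega>))"
        using f01 meas[OF X(1)] by (intro integrable_const_bound[of _ 1]) auto
      show "integrable (M n) (indicator {\<omega> \<in> space (M n). \<exists>A\<in>\<K>. \<forall>v\<in>A. X n v \<omega> \<ge> h} :: _ \<Rightarrow> real)"
        using sets[OF X(1)] by (simp add: integrable_indicator_iff emeasure_eq_measure)
      show "indicator {\<omega> \<in> space (M n). \<exists>A\<in>\<K>. \<forall>v\<in>A. X n v \<omega> \<ge> h} \<omega> \<le> f (\<lambda>v. X n v \<omega>)" for \<omega>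
        using f01 f1[of _ "\<lambda>v. X n v \<omega>"] by (auto simp: indicator_def)
    qed
    finally show ?thesis .
  qed
  moreover have "(LINT \<omega>|P. f (\<lambda>v. \<phi> v \<omega>)) \<le> \<P>(\<omega> in P. \<exists>A\<in>\<K>. \<forall>v\<in>A. \<phi> v \<omega> \<ge> h')"
  proof -
    interpret prob_space P by (rule prob_spaces)
    have "(LINT \<omega>|P. f (\<lambda>v. \<phi> v \<omega>))
      \<le> (LINT \<omega>|P. indicator {\<omega> \<in> space P. \<exists>A\<in>\<K>. \<forall>v\<in>A. \<phi> v \<omega> \<ge> h'} \<omega>)"
    proof (rule integral_mono)
      show "integrable P (\<lambda>\<omega>. f (\<lambda>v. \<phi> v \<omega>))"
        using f01 meas[OF X(2)] by (intro integrable_const_bound[of _ 1]) auto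
      show "integrable P (indicator {\<omega> \<in> space P. \<exists>A\<in>\<K>. \<forall>v\<in>A. \<phi> v \<omega> \<ge> h'} :: _ \<Rightarrow> real)"
        using sets[OF X(2)] by (simp add: integrable_indicator_iff emeasure_eq_measure)
      show "f (\<lambda>v. \<phi> v \<omega>) \<le> indicator {\<omega> \<in> space P. \<exists>A\<in>\<K>. \<forall>v\<in>A. \<phi> v \<omega> \<ge> h'} \<omega>" if "\<omega> \<in> space P" for \<omega>
        using f01 f0[of "\<lambda>v. \<phi> v \<omega>"] that by (auto simp: indicator_def)
    qed
    also have "\<dots> = \<P>(\<omega> in P. \<exists>A\<in>\<K>. \<forall>v\<in>A. \<phi> v \<omega> \<ge> h')"
      using sets[OF X(2)] by simp
    finally show ?thesis .
  qed
  ultimately show ?thesis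
    by (elim eventually_mono) (smt (verit))
qed

end

section \<open>Random walk on the torus and its Fourier transform\<close>

definition displacement :: "(nat \<Rightarrow> int ^ 'd::finite) \<Rightarrow> nat \<Rightarrow> int ^ 'd" where
  "displacement \<eta> k = (\<Sum>i<k. \<eta> i)"

lemma walk_lattice: "walk id x \<eta> k = x + displacement \<eta> k"
  by (induction k) (simp_all add: displacement_def add.assoc)

lemma walk_torus: "wrap N x = x \<Longrightarrow> walk (wrap N) x \<eta> k = wrap N (x + displacement \<eta> k)"
  by (induction k) (simp_all add: displacement_def wrap_add_wrap add.assoc)

abbreviation increments :: "(nat \<Rightarrow> int ^ 'd::finite) measure" where
  "increments \<equiv> \<Pi>\<^sub>M k\<in>UNIV. measure_pmf (pmf_of_set unit_steps)"

definition transition :: "nat \<Rightarrow> nat \<Rightarrow> int ^ 'd::finite \<Rightarrow> real" where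
  "transition N k z = \<P>(\<eta> in increments. wrap N (displacement \<eta> k) = wrap N z)"

lemma unit_steps_eq: "unit_steps = (\<lambda>(i, s). axis i s) ` (UNIV \<times> {1, -1 :: int})"
  by (auto simp: unit_steps_def)

lemma inj_axis: "inj_on (\<lambda>(i :: 'd::finite, s). axis i s) (UNIV \<times> {1, -1 :: int})"
  by (auto simp: inj_on_def axis_eq_axis)

lemma finite_unit_steps [simp]: "finite unit_steps" and unit_steps_nonempty [simp]: "unit_steps \<noteq> {}"
  by (auto simp: unit_steps_eq)

lemma card_unit_steps: "card (unit_steps :: (int ^ 'd::finite) set) = 2 * CARD('d)"
  unfolding unit_steps_eq by (simp add: card_image[OF inj_axis] card_cartesian_product mult.commute)

lemma sum_unit_steps:
  "(\<Sum>e\<in>unit_steps. f e) = (\<Sum>i\<in>UNIV. f (axis i 1) + f (axis i (-1)))"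
  for f :: "int ^ 'd::finite \<Rightarrow> 'a::comm_monoid_add"
proof -
  have "(\<Sum>e\<in>unit_steps. f e) = (\<Sum>(i, s)\<in>UNIV \<times> {1, -1}. f (axis i s))"
    unfolding unit_steps_eq by (subst sum.reindex[OF inj_axis]) (simp add: case_prod_unfold)
  also have "\<dots> = (\<Sum>i\<in>UNIV. \<Sum>s\<in>{1, -1}. f (axis i s))" by (rule sum.cartesian_product[symmetric])
  finally show ?thesis by simp
qed

text \<open>
  Independence of the coordinates of a product space means that their joint law is the product of the
  marginals, and this joint law is the product measure itself.
\<close>

lemma (in product_prob_space) indep_vars_coordinates: "I \<noteq> {} \<Longrightarrow> indep_vars M (\<lambda>i \<omega>. \<omega> i) I"
proof -
  assume "I \<noteq> {}"
  have "distr (PiM I M) (PiM I M) (\<lambda>x. \<lambda>i\<in>I. x i) = distr (PiM I M) (PiM I M) (\<lambda>x. x)"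
    by (intro distr_cong refl) (auto simp: space_PiM PiE_def extensional_restrict)
  also have "\<dots> = (\<Pi>\<^sub>M i\<in>I. distr (PiM I M) (M i) (\<lambda>\<omega>. \<omega> i))"
    unfolding distr_id by (intro PiM_cong refl) (simp add: PiM_component)
  finally show ?thesis
    by (subst indep_vars_iff_distr_eq_PiM'[OF \<open>I \<noteq> {}\<close>]) auto
qed

interpretation increments: product_prob_space "\<lambda>_ :: nat. measure_pmf (pmf_of_set unit_steps)" UNIV
  by (rule product_prob_spaceI) (rule prob_space_measure_pmf)

interpretation increments: prob_space increments
  by (rule increments.P.prob_space_axioms)

lemma measurable_displacement [measurable]:
  "(\<lambda>\<eta> :: nat \<Rightarrow> int ^ 'd::finite. displacement \<eta> k) \<in> measurable increments (count_space UNIV)"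
proof -
  have [measurable]: "(\<lambda>\<eta> :: nat \<Rightarrow> int ^ 'd. \<eta> i) \<in> measurable increments (count_space UNIV)" for i
    by (subst measurable_cong_sets[OF refl, of _ "measure_pmf (pmf_of_set unit_steps)"])
      (simp_all add: measurable_component_singleton)
  show ?thesis
  proof (induction k)
    case (Suc k)
    have "(\<lambda>\<eta> :: nat \<Rightarrow> int ^ 'd. displacement \<eta> k + \<eta> k) \<in> measurable increments (count_space UNIV)"
    proof (rule measurable_compose_countable[where f = "\<lambda>s \<eta>. s + \<eta> k", OF _ Suc])
      show "(\<lambda>\<eta> :: nat \<Rightarrow> int ^ 'd. s + \<eta> k) \<in> measurable increments (count_space UNIV)" for s
        by (rule measurable_compose[of "\<lambda>\<eta>. \<eta> k" _ "count_space UNIV" "\<lambda>e. s + e"]) simp_all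
    qed
    then show ?case by (simp add: displacement_def)
  qed (simp add: displacement_def)
qed

lemma AE_increments: "AE \<eta> in increments. \<forall>i. \<eta> i \<in> unit_steps"
  unfolding AE_all_countable
proof
  fix i :: nat
  show "AE \<eta> in increments. \<eta> i \<in> unit_steps"
    by (rule AE_PiM_component) (auto intro: prob_space_measure_pmf simp: AE_measure_pmf_iff)
qed

text \<open>
  The inner product of \<open>z\<close> with the frequency \<open>2 \<pi> \<theta> / N\<close>, for \<open>\<theta>\<close> in the dual group of the torus, which is
  again represented by \<open>torus N\<close>.
\<close>

definition phase :: "nat \<Rightarrow> int ^ 'd \<Rightarrow> int ^ 'd::finite \<Rightarrow> real" where
  "phase N \<theta> z = 2 * pi / real N * real_of_int (\<Sum>i\<in>UNIV. \<theta> $ i * z $ i)"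

text \<open>
  The eigenvalue of the transition matrix of the walk for the character with frequency \<open>\<theta>\<close>.
\<close>

definition symbol :: "nat \<Rightarrow> int ^ 'd::finite \<Rightarrow> real" where
  "symbol N \<theta> = (\<Sum>i\<in>UNIV. cos (2 * pi * real_of_int (\<theta> $ i) / real N)) / real CARD('d)"

lemma phase_add: "phase N \<theta> (x + y) = phase N \<theta> x + phase N \<theta> y"
  by (simp add: phase_def distrib_left sum.distrib)

lemma phase_diff: "phase N \<theta> (x - y) = phase N \<theta> x - phase N \<theta> y"
  using phase_add[of N \<theta> "x - y" y] by simp

lemma phase_sum: "phase N \<theta> (\<Sum>i\<in>I. x i) = (\<Sum>i\<in>I. phase N \<theta> (x i))"
  by (induction I rule: infinite_finite_induct) (simp_all add: phase_add, simp_all add: phase_def)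

lemma phase_axis: "phase N \<theta> (axis i s) = 2 * pi * real_of_int (\<theta> $ i) / real N * real_of_int s"
proof -
  have "(\<Sum>j\<in>UNIV. \<theta> $ j * axis i s $ j) = (\<Sum>j\<in>UNIV. if j = i then \<theta> $ j * s else 0)"
    by (intro sum.cong) (auto simp: axis_def)
  then show ?thesis by (simp add: phase_def)
qed

lemma cis_sum: "cis (\<Sum>i\<in>I. f i) = (\<Prod>i\<in>I. cis (f i))"
  by (induction I rule: infinite_finite_induct) (simp_all add: cis_mult[symmetric])

lemma expectation_cis_displacement:
  "(LINT \<eta>|increments. cis (phase N \<theta> (displacement \<eta> k))) = complex_of_real (symbol N \<theta> ^ k)"
proof -
  let ?U = "pmf_of_set unit_steps :: (int ^ 'a) pmf"
  have m: "(\<lambda>\<eta>. cis (phase N \<theta> (\<eta> i))) \<in> borel_measurable increments" for i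
    by (rule measurable_compose[OF measurable_component_singleton[of i UNIV "\<lambda>_. measure_pmf ?U"]]) simp_all
  have one: "(LINT \<eta>|increments. cis (phase N \<theta> (\<eta> i))) = complex_of_real (symbol N \<theta>)" for i
  proof -
    have "(LINT \<eta>|increments. cis (phase N \<theta> (\<eta> i)))
       = (LINT e|distr increments (measure_pmf ?U) (\<lambda>\<eta>. \<eta> i). cis (phase N \<theta> e))"
      by (subst integral_distr) simp_all
    also have "\<dots> = (LINT e|measure_pmf ?U. cis (phase N \<theta> e))"
      by (subst increments.PiM_component) simp_all
    also have "\<dots> = (\<Sum>e\<in>unit_steps. cis (phase N \<theta> e)) / (2 * CARD('a))"
      by (subst integral_measure_pmf[of unit_steps])
        (simp_all add: card_unit_steps scaleR_conv_of_real sum_divide_distrib divide_simps)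
    also have "\<dots> = complex_of_real (symbol N \<theta>)"
      by (simp add: sum_unit_steps phase_axis symbol_def complex_eq_iff sum_divide_distrib[symmetric]
          Re_divide_of_real Im_divide_of_real sum_distrib_left[symmetric])
    finally show ?thesis .
  qed
  have "(LINT \<eta>|increments. cis (phase N \<theta> (displacement \<eta> k)))
      = (LINT \<eta>|increments. (\<Prod>i<k. cis (phase N \<theta> (\<eta> i))))"
    by (simp add: displacement_def phase_sum cis_sum)
  also have "\<dots> = (\<Prod>i<k. LINT \<eta>|increments. cis (phase N \<theta> (\<eta> i)))"
  proof (rule increments.indep_vars_lebesgue_integral)
    have "increments.indep_vars (\<lambda>_. borel) (\<lambda>i \<eta>. cis (phase N \<theta> (\<eta> i))) UNIV"
      by (rule increments.indep_vars_compose2[OF increments.indep_vars_coordinates]) simp_all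
    then show "increments.indep_vars (\<lambda>_. borel) (\<lambda>i \<eta>. cis (phase N \<theta> (\<eta> i))) {..<k}"
      by (rule increments.indep_vars_subset) simp
    show "integrable increments (\<lambda>\<eta>. cis (phase N \<theta> (\<eta> i)))" for i
      by (rule increments.integrable_const_bound[of _ 1]) (simp_all add: m)
  qed simp
  finally show ?thesis by (simp add: one)
qed


lemma sum_roots_of_unity:
  assumes "N \<ge> 1"
  shows "(\<Sum>k\<in>{0..<int N}. cis (2 * pi / real N * real_of_int (k * m))) = (if int N dvd m then real N else 0)"
proof -
  define w where "w = cis (2 * pi / real N * real_of_int m)"
  have "(\<Sum>k\<in>{0..<int N}. cis (2 * pi / real N * real_of_int (k * m))) 
      = (\<Sum>k<N. cis (2 * pi / real N * real_of_int (int k * m)))"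
    by (rule sum.reindex_bij_witness[of _ int nat]) auto
  also have "\<dots> = (\<Sum>k<N. w ^ k)"
    unfolding w_def Complex.DeMoivre by (intro sum.cong refl arg_cong[of _ _ cis]) simp
  also have "\<dots> = (if int N dvd m then real N else 0)"
  proof (cases "int N dvd m")
    case True
    then obtain n where "m = int N * n" by (elim dvdE)
    then have "2 * pi / real N * real_of_int m = 2 * pi * real_of_int n" using assms by simp
    then have "w = 1" unfolding w_def by (simp add: cis_multiple_2pi)
    with True show ?thesis by simp
  next
    case False
    have "w \<noteq> 1"
    proof
      assume "w = 1"
      then have "cos (2 * pi / real N * real_of_int m) = 1" unfolding w_def by (simp add: complex_eq_iff)
      then obtain n :: int where "2 * pi / real N * real_of_int m = real_of_int n * 2 * pi"
        unfolding cos_one_2pi_int by blast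
      then have "real_of_int m = real_of_int (int N * n)" using assms by (simp add: field_simps)
      then have "m = int N * n" by (simp only: of_int_eq_iff)
      with False show False by simp
    qed
    moreover have "w ^ N = cis (2 * pi * real_of_int m)" using assms by (simp add: w_def Complex.DeMoivre)
    then have "w ^ N = 1" by (simp add: cis_multiple_2pi)
    ultimately show ?thesis using False by (simp add: sum_gp_strict)
  qed
  finally show ?thesis .
qed

lemma sum_torus_prod:
  fixes f :: "'d::finite \<Rightarrow> int \<Rightarrow> 'a::comm_semiring_1"
  shows "(\<Sum>\<theta>\<in>torus N. \<Prod>i\<in>UNIV. f i (\<theta> $ i)) = (\<Prod>i\<in>UNIV. \<Sum>k\<in>{0..<int N}. f i k)"
proof -
  have "(\<Prod>i\<in>UNIV. \<Sum>k\<in>{0..<int N}. f i k)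
      = (\<Sum>g\<in>PiE UNIV (\<lambda>_. {0..<int N}). \<Prod>i\<in>UNIV. f i (g i))"
    by (rule prod_sum_PiE) auto
  also have "\<dots> = (\<Sum>\<theta>\<in>torus N. \<Prod>i\<in>UNIV. f i (\<theta> $ i))"
    by (rule sum.reindex_bij_witness[of _ "($)" vec_lambda]) (auto simp: torus_def PiE_iff)
  finally show ?thesis by (rule sym)
qed

lemma card_torus: "card (torus N :: (int ^ 'd::finite) set) = N ^ CARD('d)"
  using sum_torus_prod[of "\<lambda>(_ :: 'd) _. 1 :: nat" N] by simp

text \<open>
  Orthogonality of characters; the sum over the dual group factorises over the coordinates into sums
  of roots of unity.
\<close>

lemma sum_torus_cis:
  fixes z :: "int ^ 'd::finite"
  assumes "N \<ge> 1"
  shows "(\<Sum>\<theta>\<in>torus N. cis (phase N \<theta> z)) = (if wrap N z = 0 then real N ^ CARD('d) else 0)"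
proof -
  have "(\<Sum>\<theta>\<in>torus N. cis (phase N \<theta> z))
     = (\<Sum>\<theta>\<in>torus N. \<Prod>i\<in>UNIV. cis (2 * pi / real N * real_of_int (\<theta> $ i * z $ i)))"
    by (simp only: phase_def of_int_sum sum_distrib_left cis_sum)
  also have "\<dots> = (\<Prod>i\<in>UNIV. if int N dvd z $ i then complex_of_real (real N) else 0)"
    by (subst sum_torus_prod[where f = "\<lambda>i k. cis (2 * pi / real N * real_of_int (k * z $ i))"])
      (simp only: sum_roots_of_unity[OF assms] of_real_0 if_distrib[of complex_of_real])
  also have "\<dots> = (if \<forall>i. int N dvd z $ i then real N ^ CARD('d) else 0)" by auto
  also have "(\<forall>i. int N dvd z $ i) \<longleftrightarrow> wrap N z = 0"
    by (simp add: wrap_def vec_eq_iff dvd_eq_mod_eq_0)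
  finally show ?thesis by simp
qed

lemma wrap_diff_eq_0: "wrap N (x - y) = 0 \<longleftrightarrow> wrap N x = wrap N y"
  by (simp add: wrap_def vec_eq_iff mod_eq_dvd_iff dvd_eq_mod_eq_0)

text \<open>
  Fourier inversion: the indicator of \<open>wrap N (displacement \<eta> k - z) = 0\<close> is an average of characters,
  and the expectation of each character is a power of its eigenvalue.
\<close>

theorem transition_fourier:
  fixes z :: "int ^ 'd::finite"
  assumes N: "N \<ge> 1"
  shows "transition N k z = (\<Sum>\<theta>\<in>torus N. cos (phase N \<theta> z) * symbol N \<theta> ^ k) / real N ^ CARD('d)"
proof -
  let ?S = "\<lambda>\<eta> :: nat \<Rightarrow> int ^ 'd. displacement \<eta> k"
  have i: "integrable increments (\<lambda>\<eta>. cis (phase N \<theta> (?S \<eta>)))" for \<theta>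
    by (rule increments.integrable_const_bound[of _ 1])
      (simp_all add: measurable_compose[OF measurable_displacement])
  have "complex_of_real (transition N k z)
      = (LINT \<eta>|increments. complex_of_real (indicator {\<eta> \<in> space increments. wrap N (?S \<eta>) = wrap N z} \<eta>))"
    unfolding transition_def by simp
  also have "\<dots> = (LINT \<eta>|increments. (\<Sum>\<theta>\<in>torus N. cis (phase N \<theta> (?S \<eta> - z))) / real N ^ CARD('d))"
    using N by (intro Bochner_Integration.integral_cong refl)
      (simp add: sum_torus_cis[OF N] wrap_diff_eq_0 indicator_def)
  also have "\<dots> = (LINT \<eta>|increments. (\<Sum>\<theta>\<in>torus N. cis (- phase N \<theta> z) * cis (phase N \<theta> (?S \<eta>))))
      / real N ^ CARD('d)"
    by (simp add: phase_diff cis_mult)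
  also have "(LINT \<eta>|increments. (\<Sum>\<theta>\<in>torus N. cis (- phase N \<theta> z) * cis (phase N \<theta> (?S \<eta>))))
     = (\<Sum>\<theta>\<in>torus N. cis (- phase N \<theta> z) * complex_of_real (symbol N \<theta> ^ k))"
    using i by (subst Bochner_Integration.integral_sum) (simp_all add: expectation_cis_displacement)
  finally have c: "complex_of_real (transition N k z)
     = (\<Sum>\<theta>\<in>torus N. cis (- phase N \<theta> z) * complex_of_real (symbol N \<theta> ^ k)) / real N ^ CARD('d)" .
  have "transition N k z = Re (complex_of_real (transition N k z))" by simp
  also have "\<dots> = (\<Sum>\<theta>\<in>torus N. cos (phase N \<theta> z) * symbol N \<theta> ^ k) / real N ^ CARD('d)"
    unfolding c by (simp flip: of_real_power add: Re_divide_of_real)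
  finally show ?thesis .
qed

section \<open>Uniform heat kernel bound\<close>

text \<open>
  The transition probability of the continuous-time walk. The density \<open>erlang_density k 1 t\<close> coincides
  with the Poisson weight \<open>exp (- t) * t ^ k / fact k\<close> for \<open>t \<ge> 0\<close> and vanishes for \<open>t < 0\<close>. As a function of
  \<open>t\<close> it is a probability density, and as a function of \<open>k\<close> it is the law of the number of jumps.
\<close>

definition heat :: "nat \<Rightarrow> real \<Rightarrow> int ^ 'd::finite \<Rightarrow> real" where
  "heat N t z = (\<Sum>k. erlang_density k 1 t * transition N k z)"

lemma poisson_generating: "t \<ge> 0 \<Longrightarrow> (\<lambda>k. erlang_density k 1 t * c ^ k) sums exp (- t * (1 - c))"
proof -
  assume "t \<ge> 0"
  have "(\<lambda>k. exp (- t) * ((t * c) ^ k /\<^sub>R fact k)) sums (exp (- t) * exp (t * c))"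
    by (intro sums_mult exp_converges)
  also have "(\<lambda>k. exp (- t) * ((t * c) ^ k /\<^sub>R fact k)) = (\<lambda>k. erlang_density k 1 t * c ^ k)"
    using \<open>t \<ge> 0\<close> by (auto simp: erlang_density_def power_mult_distrib divide_inverse mult_ac)
  also have "exp (- t) * exp (t * c) = exp (- t * (1 - c))"
    by (simp add: exp_add[symmetric] algebra_simps)
  finally show ?thesis .
qed

lemma heat_fourier:
  fixes z :: "int ^ 'd::finite"
  assumes "N \<ge> 1" "t \<ge> 0"
  shows "heat N t z
    = (\<Sum>\<theta>\<in>torus N. cos (phase N \<theta> z) * exp (- t * (1 - symbol N \<theta>))) / real N ^ CARD('d)"
proof -
  have "(\<lambda>k. (\<Sum>\<theta>\<in>torus N. cos (phase N \<theta> z) * (erlang_density k 1 t * symbol N \<theta> ^ k)) / real N ^ CARD('d))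
     sums ((\<Sum>\<theta>\<in>torus N. cos (phase N \<theta> z) * exp (- t * (1 - symbol N \<theta>))) / real N ^ CARD('d))"
    using assms(2) by (intro sums_divide sums_sum sums_mult poisson_generating)
  also have "(\<lambda>k. (\<Sum>\<theta>\<in>torus N. cos (phase N \<theta> z) * (erlang_density k 1 t * symbol N \<theta> ^ k)) / real N ^ CARD('d))
     = (\<lambda>k. erlang_density k 1 t * transition N k z)"
    unfolding transition_fourier[OF assms(1)] by (simp add: sum_distrib_left mult_ac)
  finally show ?thesis unfolding heat_def by (rule sums_unique[symmetric])
qed

text \<open>
  Up to the factor \<open>1 / N\<close>, the return probability at time \<open>s\<close> of the continuous-time walk on a cycle of
  length \<open>N\<close>.
\<close>

definition cycle_sum :: "nat \<Rightarrow> real \<Rightarrow> real" where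
  "cycle_sum N s = (\<Sum>k<N. exp (- s * (1 - cos (2 * pi * real k / real N))))"

lemma sum_torus_exp:
  "(\<Sum>\<theta>\<in>torus N. exp (- t * (1 - symbol N (\<theta> :: int ^ 'd::finite))))
    = cycle_sum N (t / real CARD('d)) ^ CARD('d)"
proof -
  let ?f = "\<lambda>k. exp (- (t / real CARD('d)) * (1 - cos (2 * pi * real_of_int k / real N)))"
  have "- t * (1 - symbol N \<theta>)
      = (\<Sum>i\<in>UNIV. - (t / real CARD('d)) * (1 - cos (2 * pi * real_of_int (\<theta> $ i) / real N)))"
    for \<theta> :: "int ^ 'd"
    unfolding sum_distrib_left[symmetric] sum_subtractf symbol_def by (simp add: field_simps)
  then have "exp (- t * (1 - symbol N \<theta>)) = (\<Prod>i\<in>UNIV. ?f (\<theta> $ i))" for \<theta> :: "int ^ 'd"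
    by (simp only: exp_sum[OF finite])
  then have "(\<Sum>\<theta>\<in>torus N. exp (- t * (1 - symbol N (\<theta> :: int ^ 'd))))
    = (\<Prod>i\<in>(UNIV :: 'd set). \<Sum>k\<in>{0..<int N}. ?f k)"
    by (simp only: sum_torus_prod[where f = "\<lambda>_. ?f"])
  also have "(\<Sum>k\<in>{0..<int N}. ?f k) = cycle_sum N (t / real CARD('d))"
    unfolding cycle_sum_def by (rule sum.reindex_bij_witness[of _ int nat]) auto
  finally show ?thesis by simp
qed

text \<open>
  The zero frequency contributes exactly the average \<open>1 / N\<^sup>d\<close>. The remaining terms are largest in
  modulus at \<open>z = 0\<close>, where the sum over the frequencies is a power of \<open>cycle_sum\<close>.
\<close>

lemma heat_minus_average_le:
  fixes z :: "int ^ 'd::finite"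
  assumes "N \<ge> 1" "t \<ge> 0"
  shows "\<bar>heat N t z - 1 / real N ^ CARD('d)\<bar>
    \<le> (cycle_sum N (t / real CARD('d)) ^ CARD('d) - 1) / real N ^ CARD('d)"
proof -
  let ?e = "\<lambda>\<theta> :: int ^ 'd. exp (- t * (1 - symbol N \<theta>))"
  have 0: "(0 :: int ^ 'd) \<in> torus N" using assms(1) by (simp add: torus_def)
  have z0: "symbol N (0 :: int ^ 'd) = 1" "phase N 0 z = 0" by (simp_all add: symbol_def phase_def)
  have "(\<Sum>\<theta>\<in>torus N. cos (phase N \<theta> z) * ?e \<theta>) - 1
      = (\<Sum>\<theta>\<in>torus N - {0}. cos (phase N \<theta> z) * ?e \<theta>)"
    using sum.remove[OF finite_torus 0, of "\<lambda>\<theta>. cos (phase N \<theta> z) * ?e \<theta>"] by (simp add: z0)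
  also have "\<bar>\<dots>\<bar> \<le> (\<Sum>\<theta>\<in>torus N - {0}. ?e \<theta>)"
    using abs_cos_le_one by (intro order_trans[OF sum_abs] sum_mono) (simp add: abs_mult)
  also have "\<dots> = (\<Sum>\<theta>\<in>torus N. ?e \<theta>) - 1"
    using sum.remove[OF finite_torus 0, of ?e] by (simp add: z0)
  finally have "\<bar>(\<Sum>\<theta>\<in>torus N. cos (phase N \<theta> z) * ?e \<theta>) - 1\<bar> \<le> cycle_sum N (t / real CARD('d)) ^ CARD('d) - 1"
    unfolding sum_torus_exp .
  then show ?thesis
    unfolding heat_fourier[OF assms] diff_divide_distrib[symmetric] abs_divide
    by (simp add: divide_right_mono)
qed

lemma sin_ge_half: "0 \<le> x \<Longrightarrow> x \<le> pi / 2 \<Longrightarrow> x / 2 \<le> sin x"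
proof -
  assume x: "0 \<le> x" "x \<le> pi / 2"
  have y: "y * cos y \<le> sin y" if "0 \<le> y" "y \<le> pi" for y :: real
  proof -
    have "sin 0 - 0 * cos 0 \<le> sin y - y * cos y"
    proof (rule DERIV_nonneg_imp_nondecreasing[OF that(1)])
      fix u assume u: "0 \<le> u" "u \<le> y"
      have "((\<lambda>y. sin y - y * cos y) has_real_derivative u * sin u) (at u)"
        by (auto intro!: derivative_eq_intros)
      moreover have "0 \<le> u * sin u" using u that by (intro mult_nonneg_nonneg sin_ge_zero) auto
      ultimately show "\<exists>l. ((\<lambda>y. sin y - y * cos y) has_real_derivative l) (at u) \<and> 0 \<le> l" by blast
    qed
    then show ?thesis by simp
  qed
  have c: "0 \<le> cos x" "0 \<le> cos (x / 2)" using x by (auto intro!: cos_ge_zero)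
  have "x / 2 \<le> x / 2 * (1 + cos x)" using x c by (simp add: mult_left_le_one_le field_simps)
  also have "\<dots> = 2 * (x / 2 * cos (x / 2)) * cos (x / 2)"
    using cos_double_cos[of "x / 2"] by (simp add: power2_eq_square algebra_simps)
  also have "\<dots> \<le> 2 * sin (x / 2) * cos (x / 2)"
    using y[of "x / 2"] x c by (intro mult_right_mono) auto
  also have "\<dots> = sin x" using sin_double[of "x / 2"] by simp
  finally show ?thesis .
qed

text \<open>
  By the bound on the sine and \<open>pi > 3\<close>, the factor \<open>1 - cos (2 * pi * k / N)\<close> is at least
  \<open>4 * (k / N)\<^sup>2\<close>, and a square is bounded below by a linear function: \<open>u\<^sup>2 + 1 \<ge> 2 * u\<close> with \<open>u = 2 * sqrt s * k / N\<close>. The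
  resulting terms are geometric, so that one estimate of their sum serves small and large \<open>s\<close> alike.
\<close>

lemma cycle_term_le:
  assumes N: "N \<ge> 1" and k: "2 * k \<le> N" and s: "s \<ge> 0"
  shows "exp (- s * (1 - cos (2 * pi * real k / real N))) \<le> exp 1 * exp (- (4 * sqrt s / real N)) ^ k"
proof -
  define y where "y = real k / real N"
  have y: "0 \<le> y" "y \<le> 1 / 2" using N k by (simp_all add: y_def field_simps)
  have "pi * y / 2 \<le> sin (pi * y)" using y by (intro sin_ge_half) (simp_all add: field_simps)
  then have "(pi * y / 2)\<^sup>2 \<le> (sin (pi * y))\<^sup>2" using y by (intro power_mono) auto
  moreover have "pi * pi \<ge> 3 * 3" using pi_gt3 by (intro mult_mono) auto
  then have "9 / 4 * y\<^sup>2 \<le> (pi * y / 2)\<^sup>2" 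
    using mult_right_mono[of "3 * 3" "pi * pi" "y\<^sup>2 / 4"] by (simp add: power2_eq_square field_simps)
  ultimately have "9 / 2 * y\<^sup>2 \<le> 1 - cos (2 * (pi * y))"
    using cos_double_sin[of "pi * y"] by simp
  then have c: "4 * y\<^sup>2 \<le> 1 - cos (2 * pi * y)"
    using zero_le_power2[of y] unfolding mult.assoc by linarith
  have "4 * sqrt s * y \<le> s * (4 * y\<^sup>2) + 1"
  proof -
    have "0 \<le> (2 * sqrt s * y - 1)\<^sup>2" by simp
    also have "\<dots> = s * (4 * y\<^sup>2) + 1 - 4 * sqrt s * y" using s by (simp add: power2_eq_square algebra_simps)
    finally show ?thesis by simp
  qed
  moreover have "s * (4 * y\<^sup>2) \<le> s * (1 - cos (2 * pi * y))" using c s by (rule mult_left_mono)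
  moreover have "4 * sqrt s * y = real k * (4 * sqrt s / real N)" by (simp add: y_def)
  ultimately have "- s * (1 - cos (2 * pi * y)) \<le> 1 + real k * (- (4 * sqrt s / real N))"
    unfolding minus_mult_left[symmetric] mult_minus_right by linarith
  then have "exp (- s * (1 - cos (2 * pi * y))) \<le> exp (1 + real k * (- (4 * sqrt s / real N)))"
    by (simp only: exp_le_cancel_iff)
  then show ?thesis by (simp only: exp_add exp_of_nat_mult y_def times_divide_eq_right)
qed

text \<open>
  With \<open>b = 4 * sqrt s / N\<close>, the terms \<open>k\<close> and \<open>N - k\<close> agree, so each is bounded by the geometric
  bound of the smaller index. The geometric series is at most \<open>1 / (exp b - 1)\<close>, and \<open>exp b - 1\<close> is at least
  any single term \<open>b ^ m / fact m\<close> of its power series.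
\<close>

lemma cycle_sum_le:
  assumes N: "N \<ge> 1" and s: "s > 0" and m: "m \<ge> 1"
  shows "1 \<le> cycle_sum N s" 
    and "cycle_sum N s \<le> 1 + 6 * fact m / (4 * sqrt s / real N) ^ m"
proof -
  define b where "b = 4 * sqrt s / real N"
  have b: "b > 0" using N s by (simp add: b_def)
  define r where "r = exp (- b)"
  have r: "0 < r" "r < 1" using b by (simp_all add: r_def)
  define T where "T k = exp (- s * (1 - cos (2 * pi * real k / real N)))" for k
  have split: "cycle_sum N s = 1 + (\<Sum>k\<in>{1..<N}. T k)"
  proof -
    have "{..<N} = insert 0 {1..<N}" using N by auto
    then show ?thesis unfolding cycle_sum_def T_def by simp
  qed
  then show "1 \<le> cycle_sum N s" by (simp add: T_def sum_nonneg)
  have T: "T k \<le> exp 1 * r ^ k + exp 1 * r ^ (N - k)" if k: "k \<in> {1..<N}" for k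
  proof (cases "2 * k \<le> N")
    case True
    have "T k \<le> exp 1 * r ^ k" unfolding T_def r_def b_def by (rule cycle_term_le[OF N True]) (use s in simp)
    moreover have "0 \<le> exp 1 * r ^ (N - k)" using r by simp
    ultimately show ?thesis by linarith
  next
    case False
    have "2 * pi * real k / real N = 2 * pi - 2 * pi * real (N - k) / real N"
      using k N by (simp add: field_simps of_nat_diff)
    then have "cos (2 * pi * real k / real N) = cos (2 * pi * real (N - k) / real N)"
      by (simp only: cos_diff) simp
    then have "T k = T (N - k)" by (simp only: T_def)
    also have "\<dots> \<le> exp 1 * r ^ (N - k)" unfolding T_def r_def b_def 
      using False s by (intro cycle_term_le[OF N]) auto
    finally have "T k \<le> exp 1 * r ^ (N - k)" .
    moreover have "0 \<le> exp 1 * r ^ k" using r by simp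
    ultimately show ?thesis by linarith
  qed
  have geo: "(\<Sum>k\<in>{1..<N}. r ^ k) \<le> r / (1 - r)"
  proof -
    have "(\<Sum>k\<in>{1..<N}. r ^ k) = (\<Sum>k<N - 1. r * r ^ k)"
      by (rule sum.reindex_bij_witness[of _ Suc "\<lambda>k. k - 1"]) (auto simp: power_Suc[symmetric] simp del: power_Suc)
    also have "\<dots> = r * ((1 - r ^ (N - 1)) / (1 - r))" using r by (simp add: sum_distrib_left[symmetric] sum_gp_strict)
    also have "\<dots> \<le> r / (1 - r)" using r by (simp add: divide_right_mono mult_left_le)
    finally show ?thesis .
  qed
  have reflect: "(\<Sum>k\<in>{1..<N}. r ^ (N - k)) = (\<Sum>k\<in>{1..<N}. r ^ k)"
    by (rule sum.reindex_bij_witness[of _ "\<lambda>k. N - k" "\<lambda>k. N - k"]) auto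
  have "(\<Sum>k\<in>{1..<N}. T k) \<le> (\<Sum>k\<in>{1..<N}. exp 1 * r ^ k + exp 1 * r ^ (N - k))" by (rule sum_mono[OF T])
  also have "\<dots> = 2 * exp 1 * (\<Sum>k\<in>{1..<N}. r ^ k)" 
    unfolding sum.distrib sum_distrib_left[symmetric] reflect by simp
  also have "\<dots> \<le> 2 * 3 * (r / (1 - r))"
    using exp_le geo r by (intro mult_mono sum_nonneg) auto
  also have "r / (1 - r) \<le> fact m / b ^ m"
  proof -
    have "1 + b ^ m / fact m \<le> exp b"
    proof -
      have "(\<Sum>k\<in>{0, m}. b ^ k /\<^sub>R fact k) \<le> (\<Sum>k. b ^ k /\<^sub>R fact k)"
        using b by (intro sum_le_suminf summable_exp_generic) auto
      then show ?thesis using m by (simp add: exp_def divide_inverse mult.commute)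
    qed
    moreover have "b ^ m / fact m > 0" using b by simp
    ultimately have "1 / (exp b - 1) \<le> 1 / (b ^ m / fact m)" by (intro divide_left_mono mult_pos_pos) linarith+
    moreover have "r / (1 - r) = 1 / (exp b - 1)" using b by (simp add: r_def exp_minus field_simps)
    ultimately show ?thesis by simp
  qed
  finally show "cycle_sum N s \<le> 1 + 6 * fact m / (4 * sqrt s / real N) ^ m"
    unfolding split b_def by simp
qed

text \<open>
  Write \<open>b = 4 * sqrt s / N\<close>. For \<open>b < 1\<close> (time below the mixing scale \<open>N\<^sup>2\<close>) the bound with \<open>m = 1\<close>
  gives \<open>7 / b\<close> for the sum, which is raised to the power \<open>d\<close>. For \<open>b \<ge> 1\<close> the sum is at most \<open>7\<close>, and the
  factor \<open>cycle_sum N s - 1\<close> of the difference of powers has the decay \<open>1 / b ^ d\<close>, by the bound with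
  \<open>m = d\<close>.
\<close>

lemma cycle_sum_power_le:
  assumes N: "N \<ge> 1" and s: "s > 0" and d: "d \<ge> 1"
  shows "cycle_sum N s ^ d - 1 \<le> (6 * fact d * d * 7 ^ d + 7 ^ d) / (4 * sqrt s / real N) ^ d"
proof -
  define b where "b = 4 * sqrt s / real N"
  have b: "b > 0" using N s by (simp add: b_def)
  let ?Q = "cycle_sum N s"
  note Q1 = cycle_sum_le(1)[OF N s d]
  have Q: "?Q \<le> 1 + 6 / b" using cycle_sum_le(2)[OF N s, of 1] by (simp add: b_def)
  have pos: "0 \<le> 6 * fact d * real d * 7 ^ d / b ^ d" "0 \<le> 7 ^ d / b ^ d" using b by simp_all
  have "?Q ^ d - 1 \<le> 6 * fact d * real d * 7 ^ d / b ^ d + 7 ^ d / b ^ d"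
  proof (cases "b \<ge> 1")
    case True
    have "?Q \<le> 7" using Q True divide_left_mono[of 1 b 6] by simp
    have "?Q ^ d - 1 = (?Q - 1) * (\<Sum>i<d. ?Q ^ i)" by (rule power_diff_1_eq)
    also have "\<dots> \<le> (6 * fact d / b ^ d) * (\<Sum>i<d. 7 ^ d)"
    proof (intro mult_mono sum_mono)
      show "?Q - 1 \<le> 6 * fact d / b ^ d" using cycle_sum_le(2)[OF N s d] by (simp add: b_def)
      fix i assume "i \<in> {..<d}"
      have "?Q ^ i \<le> 7 ^ i" using Q1 \<open>?Q \<le> 7\<close> by (intro power_mono) auto
      also have "\<dots> \<le> 7 ^ d" using \<open>i \<in> {..<d}\<close> by (intro power_increasing) auto
      finally show "?Q ^ i \<le> 7 ^ d" .
    qed (use Q1 b in \<open>auto intro!: sum_nonneg\<close>)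
    finally show ?thesis using pos by simp
  next
    case False
    then have "1 \<le> 1 / b" using b by simp
    then have "?Q \<le> 7 / b" using Q by simp
    then have "?Q ^ d \<le> (7 / b) ^ d" using Q1 by (intro power_mono) auto
    then show ?thesis using pos by (simp add: power_divide)
  qed
  then show ?thesis unfolding b_def add_divide_distrib .
qed

text \<open>
  The factor \<open>N ^ d\<close> cancels against the \<open>N\<close> in the definition of \<open>b\<close> above, so that the bound \<open>t powr (- d / 2)\<close>
  is uniform in \<open>N\<close>. It is integrable at infinity as soon as \<open>d \<ge> 3\<close>; the exponent \<open>3 / 2\<close> is all that is kept.
\<close>

lemma heat_bound:
  assumes d: "CARD('d::finite) \<ge> 3"
  obtains C where "C \<ge> 0" "\<And>N t (z :: int ^ 'd). N \<ge> 1 \<Longrightarrow> t \<ge> 1 \<Longrightarrow> 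
    \<bar>heat N t z - 1 / real N ^ CARD('d)\<bar> \<le> C * t powr (- 3 / 2)"
proof
  define d where "d = CARD('d)"
  define A where "A = 6 * fact d * real d * 7 ^ d + 7 ^ d"
  have A: "A \<ge> 0" by (simp add: A_def)
  show "A * real d ^ d \<ge> 0" using A by simp
  fix N :: nat and t :: real and z :: "int ^ 'd" assume N: "N \<ge> 1" and t: "t \<ge> 1"
  have d3: "d \<ge> 3" using d by (simp add: d_def)
  have "sqrt t \<ge> 1" using t by simp
  have "\<bar>heat N t z - 1 / real N ^ d\<bar> \<le> (cycle_sum N (t / real d) ^ d - 1) / real N ^ d"
    unfolding d_def using N t by (intro heat_minus_average_le) auto
  also have "\<dots> \<le> (A / (4 * sqrt (t / real d) / real N) ^ d) / real N ^ d"
    unfolding A_def using N t d3 by (intro divide_right_mono cycle_sum_power_le) auto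
  also have "\<dots> = A / (4 * sqrt (t / real d)) ^ d"
    using N by (simp add: power_divide)
  also have "\<dots> \<le> A / (sqrt t / real d) ^ d"
  proof (intro divide_left_mono power_mono A)
    have "sqrt (real d) \<le> real d" using d3 by (simp add: real_sqrt_le_iff' sqrt_le_D real_le_lsqrt power2_eq_square)
    then have "sqrt t / real d \<le> sqrt t / sqrt (real d)" using d3 t by (intro divide_left_mono) auto
    also have "\<dots> \<le> 4 * sqrt (t / real d)" unfolding real_sqrt_divide times_divide_eq_right
      using t by (intro divide_right_mono) auto
    finally show "sqrt t / real d \<le> 4 * sqrt (t / real d)" .
    show "0 < (4 * sqrt (t / real d)) ^ d * (sqrt t / real d) ^ d" using t d3 by simp
  qed (use t in simp)
  also have "\<dots> = A * real d ^ d / sqrt t ^ d" by (simp add: power_divide)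
  also have "\<dots> \<le> A * real d ^ d / sqrt t ^ 3"
    using \<open>sqrt t \<ge> 1\<close> d3 A by (intro divide_left_mono power_increasing) auto
  also have "sqrt t ^ 3 = t powr (3 / 2)"
    using t by (simp add: powr_half_sqrt[symmetric] powr_realpow[symmetric] powr_powr)
  also have "A * real d ^ d / t powr (3 / 2) = A * real d ^ d * t powr (- 3 / 2)"
    using powr_minus_divide[of t "3 / 2"] by simp
  finally show "\<bar>heat N t z - 1 / real N ^ CARD('d)\<bar> \<le> A * real d ^ d * t powr (- 3 / 2)"
    unfolding d_def .
qed

section \<open>Poisson clock\<close>

abbreviation holding_times :: "(nat \<Rightarrow> real) measure" where
  "holding_times \<equiv> \<Pi>\<^sub>M k\<in>UNIV. density lborel (\<lambda>t. ennreal (exponential_density 1 t))"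

interpretation holding_times: product_prob_space
    "\<lambda>_ :: nat. density lborel (\<lambda>t. ennreal (exponential_density 1 t))" UNIV
  by (rule product_prob_spaceI) (rule prob_space_exponential_density, simp)

interpretation holding_times: prob_space holding_times
  by (rule holding_times.P.prob_space_axioms)

lemma measurable_holding_time: "(\<lambda>\<tau>. \<tau> i) \<in> borel_measurable holding_times"
  using measurable_component_singleton[of i UNIV "\<lambda>_. density lborel (\<lambda>t. ennreal (exponential_density 1 t))"]
  by simp

text \<open>
  A sum of independent exponential variables has an Erlang law, whose distribution function is a tail
  of the Poisson weights.
\<close>

lemma jump_time_le:
  assumes "t \<ge> 0"
  shows "\<P>(\<tau> in holding_times. (\<Sum>i\<le>n. \<tau> i) \<le> t) = 1 - (\<Sum>m\<le>n. erlang_density m 1 t)"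
proof -
  have "distributed holding_times lborel (\<lambda>\<tau>. \<Sum>i\<in>{..n}. \<tau> i) (erlang_density (card {..n} - 1) 1)"
  proof (rule holding_times.exponential_distributed_sum)
    show "distributed holding_times lborel (\<lambda>\<tau>. \<tau> i) (exponential_density 1)" for i
    proof -
      have "distr holding_times lborel (\<lambda>\<tau>. \<tau> i)
          = distr holding_times (density lborel (\<lambda>t. ennreal (exponential_density 1 t))) (\<lambda>\<tau>. \<tau> i)"
        by (intro distr_cong) auto
      then show ?thesis
        unfolding distributed_def using holding_times.PiM_component[of i] by simp
    qed
    have "holding_times.indep_vars (\<lambda>_. density lborel (\<lambda>t. ennreal (exponential_density 1 t))) (\<lambda>i \<tau>. \<tau> i) UNIV"
      by (rule holding_times.indep_vars_coordinates) simp
    then have "holding_times.indep_vars (\<lambda>_. borel) (\<lambda>i \<tau>. \<tau> i) UNIV"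
      by (rule holding_times.indep_vars_compose2[where Y = "\<lambda>_ x. x"]) simp
    then show "holding_times.indep_vars (\<lambda>_. borel) (\<lambda>i \<tau>. \<tau> i) {..n}"
      by (rule holding_times.indep_vars_subset) simp
  qed auto
  then have "\<P>(\<tau> in holding_times. (\<Sum>i\<le>n. \<tau> i) \<le> t) = erlang_CDF n 1 t"
    using holding_times.erlang_distributed_le[of _ n 1 t] assms by simp
  then show ?thesis using assms by (simp add: erlang_CDF_def erlang_density_def)
qed

lemma sum_erlang: "t \<ge> 0 \<Longrightarrow> (\<lambda>m. erlang_density m 1 t) sums 1"
  using poisson_generating[of t 1] by simp

lemma measurable_jump_count [measurable]:
  "(\<lambda>\<tau>. jump_count \<tau> t) \<in> measurable holding_times (count_space UNIV)"
proof -
  note measurable_holding_time[measurable]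
  show ?thesis unfolding jump_count_def by measurable
qed

text \<open>
  Almost surely the jump times increase and eventually exceed \<open>t\<close>. Then the set that \<open>jump_count\<close> counts is
  a finite initial segment, and \<open>jump_count \<tau> t = k\<close> means that the jump time with index \<open>k - 1\<close> is at
  most \<open>t\<close> and the one with index \<open>k\<close> is larger. The probabilities of these events differ by one Poisson
  weight.
\<close>

lemma jump_count_distribution:
  assumes t: "t \<ge> 0"
  shows "\<P>(\<tau> in holding_times. jump_count \<tau> t = k) = erlang_density k 1 t"
proof -
  let ?T = "\<lambda>n \<tau>. \<Sum>i\<le>n. \<tau> i :: real"
  note measurable_holding_time[measurable]
  have pos: "AE \<tau> in holding_times. \<forall>i. 0 \<le> \<tau> i"
    unfolding AE_all_countable
  proof
    fix i :: nat
    show "AE \<tau> in holding_times. 0 \<le> \<tau> i"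
    proof (rule AE_PiM_component)
      show "AE s in density lborel (\<lambda>t. ennreal (exponential_density 1 t)). 0 \<le> s"
        by (subst AE_density) (auto simp: erlang_density_def)
    qed (auto intro!: prob_space_exponential_density)
  qed
  have "(\<lambda>n. 1 - (\<Sum>m\<le>n. erlang_density m 1 t)) \<longlonglongrightarrow> 1 - 1"
    using sum_erlang[OF t] by (intro tendsto_diff tendsto_const) (simp add: sums_def_le)
  then have lim: "(\<lambda>n. \<P>(\<tau> in holding_times. ?T n \<tau> \<le> t)) \<longlonglongrightarrow> 0"
    by (simp add: jump_time_le[OF t])
  have "\<P>(\<tau> in holding_times. \<forall>n. ?T n \<tau> \<le> t) \<le> \<P>(\<tau> in holding_times. ?T n \<tau> \<le> t)" for n
    by (rule holding_times.finite_measure_mono) auto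
  then have "\<P>(\<tau> in holding_times. \<forall>n. ?T n \<tau> \<le> t) \<le> 0"
    by (intro LIMSEQ_le_const[OF lim]) auto
  then have "\<P>(\<tau> in holding_times. \<forall>n. ?T n \<tau> \<le> t) = 0"
    by (intro antisym measure_nonneg)
  then have fin: "AE \<tau> in holding_times. \<not> (\<forall>n. ?T n \<tau> \<le> t)"
    by (intro AE_I[of _ _ "{\<tau> \<in> space holding_times. \<forall>n. ?T n \<tau> \<le> t}"])
      (auto simp: holding_times.emeasure_eq_measure)
  \<comment> \<open>Without the second hypothesis the counted set could be infinite and its cardinality \<open>0\<close>.\<close>
  have count: "jump_count \<tau> t = k \<longleftrightarrow> (\<forall>n<k. ?T n \<tau> \<le> t) \<and> \<not> ?T k \<tau> \<le> t"
    if p: "\<forall>i. 0 \<le> \<tau> i" and f: "\<not> (\<forall>n. ?T n \<tau> \<le> t)" for \<tau> k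
  proof -
    have mono: "?T m \<tau> \<le> ?T n \<tau>" if "m \<le> n" for m n
      using p that by (intro sum_mono2) auto
    define l where "l = (LEAST n. \<not> ?T n \<tau> \<le> t)"
    have l: "\<not> ?T l \<tau> \<le> t" unfolding l_def using f by (metis (mono_tags, lifting) LeastI)
    have l': "?T n \<tau> \<le> t" if "n < l" for n using not_less_Least[OF that[unfolded l_def]] by blast
    have "{n. ?T n \<tau> \<le> t} = {..<l}"
    proof (intro set_eqI iffI)
      fix n assume "n \<in> {n. ?T n \<tau> \<le> t}"
      then have "\<not> l \<le> n" using mono[of l n] l by force
      then show "n \<in> {..<l}" by simp
    qed (use l' in auto)
    then have "jump_count \<tau> t = l" by (simp add: jump_count_def)
    moreover have "(\<forall>n<k. ?T n \<tau> \<le> t) \<and> \<not> ?T k \<tau> \<le> t \<longleftrightarrow> l = k"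
      using l l' by (metis linorder_neqE_nat)
    ultimately show ?thesis by simp
  qed
  show ?thesis
  proof (cases k)
    case 0
    have "\<P>(\<tau> in holding_times. jump_count \<tau> t = k) = \<P>(\<tau> in holding_times. \<not> ?T 0 \<tau> \<le> t)"
      by (rule holding_times.finite_measure_eq_AE)
        (use pos fin in \<open>eventually_elim, simp add: count 0\<close>, measurable)
    also have "\<dots> = 1 - \<P>(\<tau> in holding_times. ?T 0 \<tau> \<le> t)"
      by (rule holding_times.prob_neg) measurable
    finally show ?thesis unfolding jump_time_le[OF t] 0 by simp
  next
    case (Suc m)
    have "\<P>(\<tau> in holding_times. jump_count \<tau> t = k)
       = holding_times.prob ({\<tau> \<in> space holding_times. ?T m \<tau> \<le> t} - {\<tau> \<in> space holding_times. ?T k \<tau> \<le> t \<and> ?T m \<tau> \<le> t})"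
    proof (rule holding_times.finite_measure_eq_AE)
      show "AE \<tau> in holding_times. \<tau> \<in> {\<tau> \<in> space holding_times. jump_count \<tau> t = k} \<longleftrightarrow>
        \<tau> \<in> {\<tau> \<in> space holding_times. ?T m \<tau> \<le> t} - {\<tau> \<in> space holding_times. ?T k \<tau> \<le> t \<and> ?T m \<tau> \<le> t}"
        using pos fin
      proof eventually_elim
        case (elim \<tau>)
        have "?T n \<tau> \<le> ?T m \<tau>" if "n < k" for n
          using elim(1) that Suc by (intro sum_mono2) auto
        then have "(\<forall>n<k. ?T n \<tau> \<le> t) \<longleftrightarrow> ?T m \<tau> \<le> t" using Suc by (auto intro: order_trans)
        then show ?case using count[OF elim, of k] by auto
      qed
    qed measurable
    also have "\<dots> = \<P>(\<tau> in holding_times. ?T m \<tau> \<le> t) - \<P>(\<tau> in holding_times. ?T k \<tau> \<le> t \<and> ?T m \<tau> \<le> t)"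
      by (rule holding_times.finite_measure_Diff) (measurable, auto)
    also have "\<P>(\<tau> in holding_times. ?T k \<tau> \<le> t \<and> ?T m \<tau> \<le> t) = \<P>(\<tau> in holding_times. ?T k \<tau> \<le> t)"
    proof (rule holding_times.finite_measure_eq_AE)
      show "AE \<tau> in holding_times. \<tau> \<in> {\<tau> \<in> space holding_times. ?T k \<tau> \<le> t \<and> ?T m \<tau> \<le> t} \<longleftrightarrow>
        \<tau> \<in> {\<tau> \<in> space holding_times. ?T k \<tau> \<le> t}"
        using pos
      proof eventually_elim
        case (elim \<tau>)
        then have "0 \<le> \<tau> (Suc m)" by blast
        then have "?T m \<tau> \<le> ?T k \<tau>" using Suc by simp
        then show ?case by auto
      qed
    qed measurable
    finally show ?thesis unfolding jump_time_le[OF t] Suc by simp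
  qed
qed

text \<open>
  Decomposition according to the number of jumps, which is independent of the increments. In
  particular the law of the increment of the walk does not depend on the starting point.
\<close>

lemma cont_walk_eq_heat:
  fixes a z :: "int ^ 'd::finite"
  assumes t: "t \<ge> 0"
  shows "\<P>(\<omega> in walk_space. cont_walk (wrap N) (wrap N a) \<omega> t = wrap N (a + z)) = heat N t z"
proof -
  interpret pair: pair_prob_space "increments :: (nat \<Rightarrow> int ^ 'd) measure" holding_times ..
  let ?A = "\<lambda>k. {\<eta> \<in> space increments. wrap N (displacement \<eta> k) = wrap N z}"
  let ?B = "\<lambda>k. {\<tau> \<in> space holding_times. jump_count \<tau> t = k}"
  have AB: "?A k \<in> sets increments" "?B k \<in> sets holding_times" for k
    by measurable
  have iff: "cont_walk (wrap N) (wrap N a) (\<eta>, \<tau>) t = wrap N (a + z)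
      \<longleftrightarrow> wrap N (displacement \<eta> (jump_count \<tau> t)) = wrap N z" for \<eta> \<tau>
    unfolding cont_walk_def walk_torus[OF wrap_wrap] wrap_add_wrap fst_conv snd_conv
      wrap_diff_eq_0[symmetric] by simp
  have "{\<omega> \<in> space (increments \<Otimes>\<^sub>M holding_times). cont_walk (wrap N) (wrap N a) \<omega> t = wrap N (a + z)}
      = (\<Union>k. ?A k \<times> ?B k)"
    by (auto simp: space_pair_measure iff)
  then have "\<P>(\<omega> in walk_space. cont_walk (wrap N) (wrap N a) \<omega> t = wrap N (a + z))
      = measure (increments \<Otimes>\<^sub>M holding_times) (\<Union>k. ?A k \<times> ?B k)"
    unfolding walk_space_def by simp
  moreover have "(\<lambda>k. measure (increments \<Otimes>\<^sub>M holding_times) (?A k \<times> ?B k))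
      sums measure (increments \<Otimes>\<^sub>M holding_times) (\<Union>k. ?A k \<times> ?B k)"
    using AB by (intro pair.P.finite_measure_UNION) (auto simp: disjoint_family_on_def)
  moreover have "measure (increments \<Otimes>\<^sub>M holding_times) (?A k \<times> ?B k)
      = erlang_density k 1 t * transition N k z" for k
    unfolding jump_count_distribution[OF t, symmetric] transition_def 
    using holding_times.P.emeasure_pair_measure_Times[OF AB, of k k]
    by (simp add: measure_def enn2real_mult mult.commute)
  ultimately show ?thesis unfolding heat_def by (simp add: sums_iff)
qed

section \<open>Convergence of the Green functions\<close>

definition lattice_transition :: "nat \<Rightarrow> int ^ 'd::finite \<Rightarrow> real" where
  "lattice_transition k z = \<P>(\<eta> in increments. displacement \<eta> k = z)"

lemma abs_displacement_le:
  assumes "\<forall>i. \<eta> i \<in> unit_steps" shows "\<bar>displacement \<eta> k $ j\<bar> \<le> int k"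
proof -
  have "\<bar>displacement \<eta> k $ j\<bar> \<le> (\<Sum>i<k. \<bar>\<eta> i $ j\<bar>)" unfolding displacement_def by simp
  also have "\<dots> \<le> (\<Sum>i<k. 1)" using assms unit_step_abs_le by (intro sum_mono) blast
  finally show ?thesis by simp
qed

text \<open>
  In \<open>k\<close> steps the walk cannot notice the periodicity of a large torus.
\<close>

lemma transition_eventually:
  fixes z :: "int ^ 'd::finite"
  shows "\<forall>\<^sub>F N in sequentially. transition N k z = lattice_transition k z"
proof -
  let ?m = "k + nat (\<Sum>j\<in>UNIV. \<bar>z $ j\<bar>)"
  have "transition N k z = lattice_transition k z" if N: "N > ?m" for N
    unfolding transition_def lattice_transition_def
  proof (rule increments.finite_measure_eq_AE)
    show "AE \<eta> in increments. \<eta> \<in> {\<eta> \<in> space increments. wrap N (displacement \<eta> k) = wrap N z}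
      \<longleftrightarrow> \<eta> \<in> {\<eta> \<in> space increments. displacement \<eta> k = z}"
      using AE_increments
    proof eventually_elim
      case (elim \<eta>)
      have "displacement \<eta> k = z" if w: "wrap N (displacement \<eta> k) = wrap N z"
        unfolding vec_eq_iff
      proof
        fix j
        have "\<bar>z $ j\<bar> \<le> (\<Sum>j\<in>UNIV. \<bar>z $ j\<bar>)" by (rule member_le_sum) auto
        with abs_displacement_le[OF elim, of k j] N
        have "\<bar>displacement \<eta> k $ j - z $ j\<bar> < int N" by linarith
        moreover have "int N dvd displacement \<eta> k $ j - z $ j"
          using w by (simp add: wrap_def vec_eq_iff mod_eq_dvd_iff)
        ultimately show "displacement \<eta> k $ j = z $ j"
          using dvd_imp_le_int[of "displacement \<eta> k $ j - z $ j" "int N"] by fastforce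
      qed
      then show ?case by auto
    qed
  qed measurable
  then show ?thesis unfolding eventually_at_top_dense by blast
qed

lemma transition_nonneg: "0 \<le> transition N k z" and transition_le_1: "transition N k z \<le> 1"
  unfolding transition_def by simp_all

lemma lattice_transition_nonneg: "0 \<le> lattice_transition k z"
  unfolding lattice_transition_def by simp

definition lattice_heat :: "real \<Rightarrow> int ^ 'd::finite \<Rightarrow> real" where
  "lattice_heat t z = (\<Sum>k. erlang_density k 1 t * lattice_transition k z)"

lemma measurable_heat [measurable]:
  "(\<lambda>t. heat N t z) \<in> borel_measurable borel" "(\<lambda>t. lattice_heat t z) \<in> borel_measurable borel"
  unfolding heat_def lattice_heat_def
  by (intro borel_measurable_suminf borel_measurable_times; simp)+

text \<open>
  Dominated convergence for the series over the number of jumps; the Poisson weights dominate.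
\<close>

lemma heat_tendsto_lattice_heat:
  assumes "t \<ge> 0" shows "(\<lambda>N. heat N t z) \<longlonglongrightarrow> lattice_heat t z"
  unfolding heat_def lattice_heat_def
proof (rule tannerys_theorem[where M = "\<lambda>k. erlang_density k 1 t", THEN conjunct2, THEN conjunct2])
  show "(\<lambda>N. erlang_density k 1 t * transition N k z) \<longlonglongrightarrow> erlang_density k 1 t * lattice_transition k z" for k
    by (intro tendsto_mult_left tendsto_eventually transition_eventually)
  show "\<forall>\<^sub>F (k, N) in at_top \<times>\<^sub>F sequentially. norm (erlang_density k 1 t * transition N k z) \<le> erlang_density k 1 t"
    by (intro always_eventually) (auto simp: abs_mult transition_nonneg transition_le_1 mult_left_le)
  show "summable (\<lambda>k. erlang_density k 1 t)" using sum_erlang[OF assms] by (rule sums_summable)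
qed simp_all

lemma heat_01:
  assumes "t \<ge> 0" shows "0 \<le> heat N t z \<and> heat N t z \<le> 1"
proof -
  interpret pair: pair_prob_space "increments :: (nat \<Rightarrow> int ^ 'a) measure" holding_times ..
  have "prob_space (walk_space :: ((nat \<Rightarrow> int ^ 'a) \<times> (nat \<Rightarrow> real)) measure)"
    unfolding walk_space_def by (rule pair.P.prob_space_axioms)
  then show ?thesis unfolding cont_walk_eq_heat[OF assms, of N 0, symmetric]
    by (simp add: prob_space.prob_le_1)
qed

lemma integrable_powr_tail: "integrable lborel (\<lambda>t. indicator {1..} t * t powr (- 3 / 2) :: real)"
proof (rule integrableI_nonneg)
  have "(\<integral>\<^sup>+t. ennreal (t powr (- 3 / 2)) * indicator {1..} t \<partial>lborel)
      = ennreal (0 - (- 2 * 1 powr (- 1 / 2)))"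
  proof (rule nn_integral_FTC_atLeast[where F = "\<lambda>t. - 2 * t powr (- 1 / 2)" and T = 0])
    show "((\<lambda>t. - 2 * t powr (- 1 / 2)) has_real_derivative x powr (- 3 / 2)) (at x)" if "1 \<le> x" for x :: real
      using that by (auto intro!: derivative_eq_intros)
    have "((\<lambda>t :: real. - 2 * t powr (- 1 / 2)) \<longlongrightarrow> - 2 * 0) at_top"
      by (intro tendsto_mult tendsto_const tendsto_neg_powr filterlim_ident) simp
    then show "((\<lambda>t :: real. - 2 * t powr (- 1 / 2)) \<longlongrightarrow> 0) at_top" by simp
  qed auto
  moreover have "(\<integral>\<^sup>+t. ennreal (indicator {1..} t * t powr (- 3 / 2)) \<partial>lborel)
      = (\<integral>\<^sup>+t. ennreal (t powr (- 3 / 2)) * indicator {1..} t \<partial>lborel)"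
    by (intro nn_integral_cong) (simp add: indicator_def)
  ultimately show "(\<integral>\<^sup>+t. ennreal (indicator {1..} t * t powr (- 3 / 2)) \<partial>lborel) < \<infinity>" by simp
qed auto

lemma green_lattice_eq: "green_lattice x y = (\<Sum>k. lattice_transition k (y - x))"
proof -
  interpret pair: pair_prob_space "increments :: (nat \<Rightarrow> int ^ 'a) measure" holding_times ..
  have "\<P>(\<omega> in walk_space. walk id x (fst \<omega>) k = y) = lattice_transition k (y - x)" for k
  proof -
    let ?A = "{\<eta> \<in> space increments. displacement \<eta> k = y - x}"
    have A: "?A \<in> sets increments" by measurable
    have "{\<omega> \<in> space (increments \<Otimes>\<^sub>M holding_times). walk id x (fst \<omega>) k = y} = ?A \<times> space holding_times"
      by (auto simp: space_pair_measure walk_lattice algebra_simps)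
    then have "\<P>(\<omega> in walk_space. walk id x (fst \<omega>) k = y)
        = measure (increments \<Otimes>\<^sub>M holding_times) (?A \<times> space holding_times)"
      unfolding walk_space_def by simp
    also have "\<dots> = lattice_transition k (y - x)"
      using holding_times.P.emeasure_pair_measure_Times[OF A sets.top]
      by (simp add: measure_def holding_times.P.emeasure_space_1 lattice_transition_def del: sets.top)
    finally show ?thesis .
  qed
  then show ?thesis unfolding green_lattice_def by simp
qed

lemma green_torus_eq:
  fixes a z :: "int ^ 'd::finite"
  shows "green_torus N (wrap N a) (wrap N (a + z))
    = (LINT t|lborel. indicator {0..} t * (heat N t z - 1 / real N ^ CARD('d)))"
  unfolding green_torus_def set_lebesgue_integral_def
  by (intro Bochner_Integration.integral_cong refl) (simp add: indicator_def cont_walk_eq_heat)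

text \<open>
  Dominated convergence in time: the integrand of the torus Green function converges pointwise to the
  lattice heat kernel, and it is bounded by \<open>1\<close> on \<open>[0, 1)\<close> and by \<open>C * t powr (- 3 / 2)\<close> afterwards,
  uniformly in \<open>N\<close>. Integrating the lattice heat kernel term by term gives the series that defines the
  lattice Green function, since each Erlang density has integral \<open>1\<close>. The base points \<open>a N\<close> are arbitrary
  by translation invariance.
\<close>

theorem green_torus_tendsto:
  fixes a :: "nat \<Rightarrow> int ^ 'd::finite"
  assumes d: "CARD('d) \<ge> 3"
  shows "(\<lambda>N. green_torus N (wrap N (a N + u)) (wrap N (a N + v))) \<longlonglongrightarrow> green_lattice u v"
proof -
  let ?z = "v - u" and ?d = "CARD('d)"
  let ?s = "\<lambda>N (t :: real). indicator {0..} t * (heat N t ?z - 1 / real N ^ ?d)"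
  let ?f = "\<lambda>t :: real. indicator {0..} t * lattice_heat t ?z"
  obtain C where C: "C \<ge> 0" "\<And>N t (z :: int ^ 'd). N \<ge> 1 \<Longrightarrow> t \<ge> 1 \<Longrightarrow>
      \<bar>heat N t z - 1 / real N ^ ?d\<bar> \<le> C * t powr (- 3 / 2)"
    using heat_bound[OF d] by blast
  let ?w = "\<lambda>t :: real. indicator {0..<1} t + C * (indicator {1..} t * t powr (- 3 / 2))"
  have meas_s: "?s N \<in> borel_measurable lborel" for N
    by (intro borel_measurable_times borel_measurable_diff) (simp_all add: measurable_heat)
  have meas_f: "?f \<in> borel_measurable lborel"
    by (intro borel_measurable_times) (simp_all add: measurable_heat)
  have w: "integrable lborel ?w"
    by (intro Bochner_Integration.integrable_add integrable_mult_right integrable_powr_tail) simp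
  have lim: "(\<lambda>N. ?s (Suc N) t) \<longlonglongrightarrow> ?f t" for t
  proof (cases "t \<ge> 0")
    case True
    have "filterlim (\<lambda>N. real N ^ ?d) at_top sequentially"
      using d by (intro filterlim_pow_at_top filterlim_real_sequentially) auto
    then have "(\<lambda>N. 1 / real N ^ ?d) \<longlonglongrightarrow> 0"
      by (intro tendsto_divide_0[OF tendsto_const] filterlim_at_top_imp_at_infinity)
    then have "(\<lambda>N. heat N t ?z - 1 / real N ^ ?d) \<longlonglongrightarrow> lattice_heat t ?z - 0"
      by (intro tendsto_diff heat_tendsto_lattice_heat True)
    then have "(\<lambda>N. heat (Suc N) t ?z - 1 / real (Suc N) ^ ?d) \<longlonglongrightarrow> lattice_heat t ?z - 0"
      by (rule LIMSEQ_Suc)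
    then show ?thesis using True by simp
  qed simp
  have bound: "norm (?s (Suc N) t) \<le> ?w t" for N t
  proof -
    consider "t < 0" | "0 \<le> t" "t < 1" | "1 \<le> t" by linarith
    then show ?thesis
    proof cases
      case 2
      have "0 \<le> 1 / real (Suc N) ^ ?d" "1 / real (Suc N) ^ ?d \<le> 1" by simp_all
      with heat_01[OF 2(1), of "Suc N" ?z] have "\<bar>heat (Suc N) t ?z - 1 / real (Suc N) ^ ?d\<bar> \<le> 1"
        by linarith
      then show ?thesis using 2 C(1) by (simp add: indicator_def)
    next
      case 3
      then show ?thesis using C(2)[of "Suc N" t ?z] by (simp add: indicator_def)
    qed (use C(1) in \<open>simp add: indicator_def\<close>)
  qed
  note dc = meas_f meas_s w AE_I2[OF lim] AE_I2[OF bound]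
  have conv: "(\<lambda>N. LINT t|lborel. ?s (Suc N) t) \<longlonglongrightarrow> (LINT t|lborel. ?f t)"
    by (rule integral_dominated_convergence[OF dc])
  have int_f: "integrable lborel ?f"
    by (rule integrable_dominated_convergence[OF dc])
  have sums: "(\<lambda>k. erlang_density k 1 t * lattice_transition k ?z) sums lattice_heat t ?z" if "t \<ge> 0" for t
    unfolding lattice_heat_def
  proof (intro summable_sums summable_comparison_test[OF _ sums_summable[OF sum_erlang[OF that]]] exI allI impI)
    fix k
    have "lattice_transition k ?z \<le> 1" unfolding lattice_transition_def by simp
    then show "norm (erlang_density k 1 t * lattice_transition k ?z) \<le> erlang_density k 1 t"
      by (simp add: abs_mult lattice_transition_nonneg mult_left_le)
  qed
  have f0: "0 \<le> ?f t" for t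
  proof (cases "t \<ge> 0")
    case True
    have "0 \<le> lattice_heat t ?z"
      by (rule sums_le[OF _ sums_zero sums[OF True]]) (simp add: lattice_transition_nonneg)
    then show ?thesis by simp
  qed simp
  have "ennreal (LINT t|lborel. ?f t) = (\<integral>\<^sup>+t. ennreal (?f t) \<partial>lborel)"
    using int_f f0 by (simp add: nn_integral_eq_integral)
  also have "\<dots> = (\<integral>\<^sup>+t. (\<Sum>k. ennreal (erlang_density k 1 t * lattice_transition k ?z)) \<partial>lborel)"
  proof (rule nn_integral_cong)
    fix t
    show "ennreal (?f t) = (\<Sum>k. ennreal (erlang_density k 1 t * lattice_transition k ?z))"
    proof (cases "t \<ge> 0")
      case True
      have "(\<Sum>k. ennreal (erlang_density k 1 t * lattice_transition k ?z))
          = ennreal (\<Sum>k. erlang_density k 1 t * lattice_transition k ?z)"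
        by (rule suminf_ennreal2)
          (simp add: lattice_transition_nonneg, rule sums_summable[OF sums[OF True]])
      with True show ?thesis by (simp add: lattice_heat_def)
    qed (simp add: erlang_density_def)
  qed
  also have "\<dots> = (\<Sum>k. \<integral>\<^sup>+t. ennreal (erlang_density k 1 t * lattice_transition k ?z) \<partial>lborel)"
    by (rule nn_integral_suminf) measurable
  also have "\<dots> = (\<Sum>k. ennreal (lattice_transition k ?z))"
  proof (rule suminf_cong)
    fix k
    interpret prob_space "density lborel (\<lambda>t. ennreal (erlang_density k 1 t))"
      by (rule prob_space_erlang_density) simp
    have "(\<integral>\<^sup>+t. ennreal (erlang_density k 1 t) \<partial>lborel) = 1"
      using emeasure_space_1 by (simp add: emeasure_density)
    moreover have "(\<integral>\<^sup>+t. ennreal (erlang_density k 1 t * lattice_transition k ?z) \<partial>lborel)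
        = (\<integral>\<^sup>+t. ennreal (erlang_density k 1 t) * ennreal (lattice_transition k ?z) \<partial>lborel)"
      by (intro nn_integral_cong ennreal_mult) (simp_all add: lattice_transition_nonneg)
    moreover have "\<dots> = (\<integral>\<^sup>+t. ennreal (erlang_density k 1 t) \<partial>lborel) * ennreal (lattice_transition k ?z)"
      by (rule nn_integral_multc) measurable
    ultimately show "(\<integral>\<^sup>+t. ennreal (erlang_density k 1 t * lattice_transition k ?z) \<partial>lborel) = ennreal (lattice_transition k ?z)"
      by (simp only: mult_1)
  qed
  finally have e: "ennreal (LINT t|lborel. ?f t) = (\<Sum>k. ennreal (lattice_transition k ?z))" .
  \<comment> \<open>The series is finite because the limit integrand is integrable: transience of the walk comes
    out of the heat kernel bound.\<close>
  then have summ: "summable (\<lambda>k. lattice_transition k ?z)"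
    by (intro summable_suminf_not_top lattice_transition_nonneg) (metis ennreal_neq_top)
  then have "(\<Sum>k. ennreal (lattice_transition k ?z)) = ennreal (\<Sum>k. lattice_transition k ?z)"
    by (intro suminf_ennreal2 lattice_transition_nonneg)
  with e have "(LINT t|lborel. ?f t) = green_lattice u v"
    unfolding green_lattice_eq using f0 summ
    by (simp add: ennreal_inj suminf_nonneg lattice_transition_nonneg integral_nonneg)
  with conv have "(\<lambda>N. LINT t|lborel. ?s N t) \<longlonglongrightarrow> green_lattice u v"
    by (simp add: LIMSEQ_imp_Suc)
  moreover have "green_torus N (wrap N (a N + u)) (wrap N (a N + v)) = (LINT t|lborel. ?s N t)" for N
    using green_torus_eq[of N "a N + u" ?z] by (simp add: add.assoc)
  ultimately show ?thesis by simp
qed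

section \<open>From giant components to crossings\<close>

text \<open>
  The crossing events decrease to percolation as the cubes grow. Above the critical value there is a
  level \<open>h' < h\<close> at which percolation has probability zero, and percolation at \<open>h\<close> implies percolation at
  \<open>h'\<close>.
\<close>

lemma lattice_gff_crossing_vanishes:
  fixes \<phi> :: "int ^ 'd::finite \<Rightarrow> 'b \<Rightarrow> real"
  assumes G: "lattice_gff P \<phi>" and h: "ereal h > h_star P \<phi>"
  shows "(\<lambda>R. \<P>(\<omega> in P. crosses R {v. \<phi> v \<omega> \<ge> h})) \<longlonglongrightarrow> 0"
proof -
  have field: "centered_gaussian_field P UNIV \<phi> green_lattice" using G by (simp add: lattice_gff_def)
  interpret prob_space P using field by (simp add: centered_gaussian_field_def)
  note \<phi> = centered_gaussian_field_single(1)[OF field UNIV_I]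
  have level: "level_set UNIV (\<lambda>x. \<phi> x \<omega>) a = {v. \<phi> v \<omega> \<ge> a}" for \<omega> a
    by (simp add: level_set_def)
  let ?A = "\<lambda>a R. {\<omega> \<in> space P. crosses R {v. \<phi> v \<omega> \<ge> a}}"
  have crosses_iff: "crosses R {v. \<phi> v \<omega> \<ge> a} \<longleftrightarrow> (\<exists>A\<in>crossing_sets R. \<forall>v\<in>A. \<phi> v \<omega> \<ge> a)" for R \<omega> a
    unfolding crosses_def by blast
  have meas: "?A a R \<in> sets P" for a R
    unfolding crosses_iff
    using finite_crossing_sets finite_crossing_set \<phi> by (rule sets_increasing_event)
  have perc: "{\<omega> \<in> space P. percolates (\<lambda>x. \<phi> x \<omega>) a} = (\<Inter>R. ?A a R)" for a
    by (auto simp: percolates_iff level)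
  have "decseq (?A h)"
    unfolding decseq_Suc_iff by (intro allI Collect_mono impI conjI; elim conjE) (assumption, rule crosses_Suc)
  then have "(\<lambda>R. prob (?A h R)) \<longlonglongrightarrow> prob (\<Inter>R. ?A h R)"
    using meas by (intro finite_Lim_measure_decseq) auto
  moreover have "prob (\<Inter>R. ?A h R) = 0"
  proof -
    obtain h' where h': "\<P>(\<omega> in P. percolates (\<lambda>x. \<phi> x \<omega>) h') = 0" "h' < h"
      using h unfolding h_star_def INF_less_iff by auto
    have "prob (\<Inter>R. ?A h R) \<le> prob (\<Inter>R. ?A h' R)"
    proof (rule finite_measure_mono)
      have "{v. \<phi> v \<omega> \<ge> h} \<subseteq> {v. \<phi> v \<omega> \<ge> h'}" for \<omega> using h'(2) by auto
      then have "?A h R \<subseteq> ?A h' R" for R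
        by (intro Collect_mono impI conjI; elim conjE) (assumption, rule crosses_mono)
      then show "(\<Inter>R. ?A h R) \<subseteq> (\<Inter>R. ?A h' R)" by (rule INF_mono') 
      show "(\<Inter>R. ?A h' R) \<in> sets P" using meas by (intro sets.countable_INT) auto
    qed
    also have "\<dots> = 0" using h'(1) unfolding perc .
    finally show ?thesis by (simp add: measure_le_0_iff)
  qed
  ultimately show ?thesis by simp
qed

text \<open>
  A first moment bound. If the largest component has at least \<open>\<xi> * N ^ d\<close> vertices, then each of these
  vertices sees a crossing of \<open>cube R\<close>. Hence the expected number of vertices that see a crossing is at least
  \<open>\<xi> * N ^ d\<close> times the probability of a giant component, and some vertex \<open>x\<close> attains the average.
\<close>

lemma giant_component_probability_le:
  fixes \<Psi> :: "int ^ 'd::finite \<Rightarrow> 'a \<Rightarrow> real"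
  assumes G: "zero_average_gff N M \<Psi>" and N: "N \<ge> 1"
    and large: "real (card (cube R :: (int ^ 'd) set)) < \<xi> * real N ^ CARD('d)"
  obtains x where "x \<in> torus N"
    "\<xi> * \<P>(\<omega> in M. real (card (C_max N (\<lambda>x. \<Psi> x \<omega>) h)) \<ge> \<xi> * real N ^ CARD('d))
      \<le> \<P>(\<omega> in M. crosses R {v. \<Psi> (wrap N (x + v)) \<omega> \<ge> h})"
proof -
  have field: "centered_gaussian_field M (torus N) \<Psi> (green_torus N)"
    using G by (simp add: zero_average_gff_def)
  interpret prob_space M using field by (simp add: centered_gaussian_field_def)
  let ?E = "\<lambda>\<omega>. level_set (torus N) (\<lambda>x. \<Psi> x \<omega>) h"
  let ?A = "\<lambda>x. {\<omega> \<in> space M. crosses R {v. \<Psi> (wrap N (x + v)) \<omega> \<ge> h}}"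
  let ?big = "{\<omega> \<in> space M. real (card (C_max N (\<lambda>x. \<Psi> x \<omega>) h)) \<ge> \<xi> * real N ^ CARD('d)}"
  let ?n = "real N ^ CARD('d)"
  have n: "?n > 0" using N by simp
  have \<Psi>: "\<Psi> (wrap N u) \<in> borel_measurable M" for u
    using centered_gaussian_field_single(1)[OF field wrap_in_torus[OF N]] .
  have A: "?A x \<in> sets M" for x
  proof -
    have "?A x = {\<omega> \<in> space M. \<exists>A\<in>crossing_sets R. \<forall>v\<in>A. \<Psi> (wrap N (x + v)) \<omega> \<ge> h}"
      unfolding crosses_def by blast
    also have "\<dots> \<in> sets M"
      using finite_crossing_sets finite_crossing_set \<Psi> by (rule sets_increasing_event)
    finally show ?thesis .
  qed
  have big: "?big \<in> sets M"
  proof -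
    have E: "{\<omega> \<in> space M. ?E \<omega> = S} \<in> sets M" if "S \<subseteq> torus N" for S
    proof -
      have m: "\<Psi> x \<in> borel_measurable M" if "x \<in> torus N" for x
        using centered_gaussian_field_single(1)[OF field that] .
      have "{\<omega> \<in> space M. ?E \<omega> = S} = {\<omega> \<in> space M. \<forall>x\<in>torus N. \<Psi> x \<omega> \<ge> h \<longleftrightarrow> x \<in> S}"
        using that unfolding level_set_def by blast
      also have "\<dots> \<in> sets M"
      proof (rule sets.sets_Collect_finite_All)
        fix x :: "int ^ 'd" assume "x \<in> torus N"
        note m[OF this, measurable]
        show "{\<omega> \<in> space M. h \<le> \<Psi> x \<omega> \<longleftrightarrow> x \<in> S} \<in> sets M" by measurable
      qed simp
      finally show ?thesis .
    qed
    \<comment> \<open>The event depends only on the level set, which has finitely many possible values.\<close>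
    define Q where "Q S \<longleftrightarrow> real (card (if S = {} then {} else ARG_MAX card C. C \<in> components (wrap N) S)) \<ge> \<xi> * ?n"
      for S :: "(int ^ 'd) set"
    have "?big = (\<Union>S\<in>{S \<in> Pow (torus N). Q S}. {\<omega> \<in> space M. ?E \<omega> = S})"
    proof -
      have "real (card (C_max N (\<lambda>x. \<Psi> x \<omega>) h)) \<ge> \<xi> * ?n \<longleftrightarrow> Q (?E \<omega>)" for \<omega>
        by (simp only: C_max_def Let_def Q_def)
      moreover have "?E \<omega> \<in> Pow (torus N)" for \<omega> by (auto simp: level_set_def)
      ultimately show ?thesis by simp blast
    qed
    also have "\<dots> \<in> sets M" using E by (intro sets.finite_UN) auto
    finally show ?thesis .
  qed
  have count: "\<xi> * ?n * indicator ?big \<omega> \<le> (\<Sum>x\<in>torus N. indicator (?A x) \<omega>)" if \<omega>: "\<omega> \<in> space M" for \<omega>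
  proof (cases "\<omega> \<in> ?big")
    case True
    let ?C = "C_max N (\<lambda>x. \<Psi> x \<omega>) h"
    have "\<omega> \<in> ?A x" if "x \<in> ?C" for x
    proof -
      have x: "x \<in> ?E \<omega>" "component (wrap N) (?E \<omega>) x = ?C"
        using C_max_vertices[OF that] by simp_all
      have "card (cube R :: (int ^ 'd) set) < card (component (wrap N) (?E \<omega>) x)"
        using True large unfolding x(2) by simp
      then have "crosses R {v. wrap N (x + v) \<in> ?E \<omega>}"
        using x(1) by (intro torus_large_component_crosses) (auto simp: level_set_def)
      moreover have "{v. wrap N (x + v) \<in> ?E \<omega>} \<subseteq> {v. \<Psi> (wrap N (x + v)) \<omega> \<ge> h}"
        by (auto simp: level_set_def)
      ultimately show ?thesis using \<omega> crosses_mono by blast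
    qed
    then have "(\<Sum>x\<in>?C. indicator (?A x) \<omega>) = (\<Sum>x\<in>?C. 1 :: real)"
      by (intro sum.cong refl indicator_simps(1))
    moreover have "?C \<subseteq> torus N"
    proof
      fix x assume "x \<in> ?C"
      then have "x \<in> ?E \<omega>" by (rule C_max_vertices(1))
      then show "x \<in> torus N" by (simp add: level_set_def)
    qed
    then have "(\<Sum>x\<in>?C. indicator (?A x) \<omega>) \<le> (\<Sum>x\<in>torus N. indicator (?A x) \<omega> :: real)"
      by (intro sum_mono2) simp_all
    ultimately have "real (card ?C) \<le> (\<Sum>x\<in>torus N. indicator (?A x) \<omega>)" by simp
    moreover have "\<xi> * ?n \<le> real (card ?C)" using True by blast
    ultimately show ?thesis unfolding indicator_simps(1)[OF True] mult_1_right by linarith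
  next
    case False
    show ?thesis unfolding indicator_simps(2)[OF False] mult_zero_right
      by (intro sum_nonneg indicator_pos_le)
  qed
  have ind: "integrable M (indicator S :: 'a \<Rightarrow> real)" "(LINT \<omega>|M. indicator S \<omega>) = prob S"
    if "S \<in> sets M" for S
    using that by (simp_all add: integrable_indicator_iff emeasure_eq_measure)
  have "\<xi> * ?n * prob ?big = (LINT \<omega>|M. \<xi> * ?n * indicator ?big \<omega>)"
    by (simp only: integral_mult_right_zero ind(2)[OF big])
  also have "\<dots> \<le> (LINT \<omega>|M. (\<Sum>x\<in>torus N. indicator (?A x) \<omega>))"
    by (intro integral_mono Bochner_Integration.integrable_sum integrable_mult_right ind(1) big A count)
  also have "\<dots> = (\<Sum>x\<in>torus N. LINT \<omega>|M. indicator (?A x) \<omega>)"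
    by (intro Bochner_Integration.integral_sum ind(1) A)
  also have "\<dots> = (\<Sum>x\<in>torus N. prob (?A x))" by (simp only: ind(2)[OF A])
  finally have le: "\<xi> * ?n * prob ?big \<le> (\<Sum>x\<in>torus N. prob (?A x))" .
  have "\<exists>x\<in>torus N. \<xi> * prob ?big \<le> prob (?A x)"
  proof (rule ccontr)
    assume "\<not> ?thesis"
    then have "prob (?A x) < \<xi> * prob ?big" if "x \<in> torus N" for x
      using that by (meson not_le)
    then have "(\<Sum>x\<in>torus N. prob (?A x)) < (\<Sum>x\<in>(torus N :: (int ^ 'd) set). \<xi> * prob ?big)"
      using wrap_in_torus[OF N] by (intro sum_strict_mono finite_torus) blast+
    also have "\<dots> = \<xi> * ?n * prob ?big" by (simp only: sum_constant card_torus of_nat_power mult_ac)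
    finally show False using le by linarith
  qed
  then show ?thesis using that by (elim bexE)
qed

theorem theorem4p1:
  fixes P_torus :: "nat \<Rightarrow> 'a measure"
    and \<Psi> :: "nat \<Rightarrow> int ^ 'd::finite \<Rightarrow> 'a \<Rightarrow> real"
    and P_lattice :: "'b measure"
    and \<phi> :: "int ^ 'd \<Rightarrow> 'b \<Rightarrow> real"
    and h \<xi> :: real
  assumes "CARD('d) \<ge> 3"
    and "\<And>N. N \<ge> 1 \<Longrightarrow> zero_average_gff N (P_torus N) (\<Psi> N)"
    and "lattice_gff P_lattice \<phi>"
    and "ereal h > h_star P_lattice \<phi>"
    and "\<xi> > 0"
  shows "(\<lambda>N. \<P>(\<omega> in P_torus N.
            real (card (C_max N (\<lambda>x. \<Psi> N x \<omega>) h)) \<ge> \<xi> * real N ^ CARD('d)))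
          \<longlonglongrightarrow> 0"
proof (rule LIMSEQ_I)
  let ?p = "\<lambda>N. \<P>(\<omega> in P_torus N. real (card (C_max N (\<lambda>x. \<Psi> N x \<omega>) h)) \<ge> \<xi> * real N ^ CARD('d))"
  fix r :: real assume r: "r > 0"
  have field: "centered_gaussian_field P_lattice UNIV \<phi> green_lattice"
    using assms(3) by (simp add: lattice_gff_def)
  \<comment> \<open>A level strictly between the critical value and \<open>h\<close>, to be reached through the limit in law.\<close>
  obtain h' where h': "h_star P_lattice \<phi> < ereal h'" "h' < h"
    using ereal_dense2[OF assms(4)] by auto
  have \<epsilon>: "\<xi> * r / 2 > 0" using r assms(5) by simp
  from order_tendstoD(2)[OF lattice_gff_crossing_vanishes[OF assms(3) h'(1)] \<epsilon>]
  obtain R where R: "\<P>(\<omega> in P_lattice. crosses R {v. \<phi> v \<omega> \<ge> h'}) < \<xi> * r / 2"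
    by (auto simp: eventually_sequentially)
  have "filterlim (\<lambda>N. \<xi> * real N ^ CARD('d)) at_top sequentially"
    using assms(5) by (intro filterlim_tendsto_pos_mult_at_top[OF tendsto_const] filterlim_pow_at_top
      filterlim_real_sequentially) auto
  then have large: "\<forall>\<^sub>F N in sequentially. real (card (cube R :: (int ^ 'd) set)) < \<xi> * real N ^ CARD('d)"
    by (simp add: filterlim_at_top_dense)
  define good where "good N x \<longleftrightarrow> \<xi> * ?p N \<le> \<P>(\<omega> in P_torus N. crosses R {v. \<Psi> N (wrap N (x + v)) \<omega> \<ge> h})" for N x
  \<comment> \<open>The centres vary with \<open>N\<close>; invariance of the law under translations is only needed at the level of
    the covariances, where it is part of the convergence of the Green functions.\<close>
  define a where "a N = (SOME x. good N x)" for N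
  have a: "good N (a N)" if "N \<ge> 1" "real (card (cube R :: (int ^ 'd) set)) < \<xi> * real N ^ CARD('d)" for N
    unfolding a_def
    by (rule someI_ex, rule giant_component_probability_le[OF assms(2)[OF that(1)] that, of h])
      (auto simp: good_def)
  \<comment> \<open>The index is shifted since there is no field on the torus with \<open>N = 0\<close>.\<close>
  have "\<forall>\<^sub>F n in sequentially.
      \<P>(\<omega> in P_torus (Suc n). \<exists>A\<in>crossing_sets R. \<forall>v\<in>A. \<Psi> (Suc n) (wrap (Suc n) (a (Suc n) + v)) \<omega> \<ge> h)
      < \<P>(\<omega> in P_lattice. \<exists>A\<in>crossing_sets R. \<forall>v\<in>A. \<phi> v \<omega> \<ge> h') + \<xi> * r / 2"
  proof (rule increasing_event_limit[where D = green_lattice and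
      K = "\<lambda>n u v. green_torus (Suc n) (wrap (Suc n) (a (Suc n) + u)) (wrap (Suc n) (a (Suc n) + v))"])
    show "centered_gaussian_field (P_torus (Suc n)) UNIV (\<lambda>v. \<Psi> (Suc n) (wrap (Suc n) (a (Suc n) + v)))
        (\<lambda>u v. green_torus (Suc n) (wrap (Suc n) (a (Suc n) + u)) (wrap (Suc n) (a (Suc n) + v)))" for n
      using assms(2)[of "Suc n"] wrap_in_torus[of "Suc n"]
      by (intro centered_gaussian_field_reindex) (auto simp: zero_average_gff_def)
    show "(\<lambda>n. green_torus (Suc n) (wrap (Suc n) (a (Suc n) + u)) (wrap (Suc n) (a (Suc n) + v)))
        \<longlonglongrightarrow> green_lattice u v" for u v
      by (rule LIMSEQ_Suc[OF green_torus_tendsto[OF assms(1)]])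
  qed (use field finite_crossing_sets finite_crossing_set h'(2) \<epsilon> in auto)
  then have "\<forall>\<^sub>F N in sequentially.
      \<P>(\<omega> in P_torus N. crosses R {v. \<Psi> N (wrap N (a N + v)) \<omega> \<ge> h})
      < \<P>(\<omega> in P_lattice. crosses R {v. \<phi> v \<omega> \<ge> h'}) + \<xi> * r / 2"
    unfolding eventually_sequentially_Suc[symmetric, where P = "\<lambda>N. \<P>(\<omega> in P_torus N. crosses R {v. \<Psi> N (wrap N (a N + v)) \<omega> \<ge> h})
      < \<P>(\<omega> in P_lattice. crosses R {v. \<phi> v \<omega> \<ge> h'}) + \<xi> * r / 2"]
    by (simp add: crosses_def subset_eq)
  with large eventually_ge_at_top[of 1] have "\<forall>\<^sub>F N in sequentially. norm (?p N - 0) < r"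
  proof eventually_elim
    case (elim N)
    have "\<xi> * ?p N < \<xi> * r" using a[OF elim(2,1)] elim(3) R unfolding good_def by linarith
    then show ?case using assms(5) by simp
  qed
  then show "\<exists>no. \<forall>n\<ge>no. norm (?p n - 0) < r" unfolding eventually_sequentially .
qed

end
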